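(* Let $n\ge 2$. There exists a function $f\in L^1(\mathbb S^n)$ such that $$\limsup_{N\rightarrow\infty}\big|S_N^{\frac{n-1}{2}} f(x)\big|=\infty\quad\text{for almost every } x\in\mathbb S^n,$$ where $S_N^{\delta}f$ denotes the $N$-th Cesàro $(C,\delta)$ mean of the spherical harmonic expansion of $f$.
   Context: $\mathbb S^n\subset\mathbb R^{n+1}$ is the unit sphere with the uniform measure $dy$ (normalized to total mass $1$). For $f\in L^1(\mathbb S^n)$ and $k=0,1,\dots$, $\mathrm{proj}_k f$ is the spherical harmonic component of degree $k$ of $f$: $$\mathrm{proj}_k f(x)=\int_{\mathbb S^n} Z_k(x,y) f(y)\,dy,\qquad Z_k(x,y)=\frac{k+\lambda}{\lambda}\,C_k^\lambda(\langle x,y\rangle),\quad \lambda=\frac{n-1}{2},$$ with $C_k^\lambda$ the Gegenbauer polynomial of degree $k$ and index $\lambda$; on $L^2(\mathbb S^n)$ it is the orthogonal projection onto the space of spherical harmonics of degree $k$. For $\delta>-1$ the Cesàro $(C,\delta)$ means are $$S^\delta_N f = \frac{1}{A_N^\delta}\sum_{k=0}^{N} A_{N-k}^\delta\, \mathrm{proj}_k f,\quad N=0,1,\dots,\qquad A_k^\delta=\binom{k+\delta}{k}=\frac{\Gamma(k+\delta+1)}{\Gamma(k+1)\Gamma(\delta+1)}.$$ *)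

theory Defs
  imports "HOL-Probability.Probability"
begin

text \<open>
  The uniform probability measure on the unit sphere, realised as the normalised cone measure:
  a Borel set \<open>B\<close> of unit vectors gets the proportion of the unit ball that is occupied by
  \<open>{r *\<^sub>R y | r y. y \<in> B \<and> 0 < r \<and> r < 1}\<close>. Here \<open>sgn x = x /\<^sub>R norm x\<close> is radial
  projection; the exceptional point \<open>0\<close> is a null set.
\<close>
definition sphere_measure :: "'a::euclidean_space measure" where
  "sphere_measure =
     restrict_space (distr (uniform_measure lborel (ball 0 1)) borel sgn) (sphere 0 1)"

lemma space_sphere_measure [simp]:
  "space (sphere_measure :: 'a::euclidean_space measure) = sphere 0 1"
  by (simp add: sphere_measure_def space_restrict_space)

lemma sets_sphere_measure [measurable_cong]:
  "sets (sphere_measure :: 'a::euclidean_space measure) = sets (restrict_space borel (sphere 0 1))"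
  by (simp add: sphere_measure_def sets_restrict_space)

lemma prob_space_uniform_ball:
  "prob_space (uniform_measure lborel (ball (0::'a::euclidean_space) 1))"
proof (rule prob_space_uniform_measure)
  have "0 < measure lborel (ball (0::'a) 1)"
    using content_ball_pos[of 1 "0::'a"] by simp
  then show "emeasure lborel (ball (0::'a) 1) \<noteq> 0"
    by (auto simp: measure_def)
  show "emeasure lborel (ball (0::'a) 1) \<noteq> \<infinity>"
    using emeasure_lborel_ball_finite[of "0::'a" 1] by auto
qed

lemma prob_space_sphere_measure:
  "prob_space (sphere_measure :: 'a::euclidean_space measure)"
proof (rule prob_spaceI)
  let ?U = "uniform_measure lborel (ball (0::'a) 1)"
  interpret prob_space ?U by (rule prob_space_uniform_ball)
  have m: "sgn \<in> measurable ?U (borel :: 'a measure)"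
    by measurable
  have "AE x in lborel. x \<in> ball (0::'a) 1 \<longrightarrow> x \<noteq> 0"
    using AE_lborel_singleton[of "0::'a"] by eventually_elim simp
  then have "AE x in ?U. x \<noteq> 0"
    by (rule AE_uniform_measureI[rotated]) simp
  then have ae: "AE x in ?U. x \<in> sgn -` sphere 0 1 \<inter> space ?U"
    by eventually_elim (simp add: norm_sgn)
  have "emeasure sphere_measure (space (sphere_measure :: 'a measure))
          = emeasure (distr ?U borel sgn) (sphere 0 1)"
    by (simp add: sphere_measure_def space_restrict_space emeasure_restrict_space)
  also have "\<dots> = emeasure ?U (sgn -` sphere 0 1 \<inter> space ?U)"
    by (rule emeasure_distr[OF m]) simp
  also have "\<dots> = 1"
    by (rule emeasure_eq_1_AE[OF _ ae]) (rule measurable_sets[OF m], simp)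
  finally show "emeasure sphere_measure (space (sphere_measure :: 'a measure)) = 1" .
qed

text \<open>The Gegenbauer polynomials \<open>C\<^sub>k\<^sup>\<nu>(t)\<close>, i.e. the coefficients of \<open>z ^ k\<close> in
  \<open>(1 - 2 * t * z + z\<^sup>2) powr (- \<nu>)\<close>, by their three-term recurrence.\<close>
fun gegenbauer :: "real \<Rightarrow> nat \<Rightarrow> real \<Rightarrow> real" where
  "gegenbauer \<nu> 0 t = 1"
| "gegenbauer \<nu> (Suc 0) t = 2 * \<nu> * t"
| "gegenbauer \<nu> (Suc (Suc k)) t =
     (2 * (real k + 1 + \<nu>) * t * gegenbauer \<nu> (Suc k) t
       - (real k + 2 * \<nu>) * gegenbauer \<nu> k t) / (real k + 2)"

text \<open>In the following, \<open>n\<close> is the dimension of the sphere, so the type \<open>'a\<close> is meant to have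
  dimension \<open>n + 1\<close>. Only the values of \<open>f\<close> on the unit sphere matter.\<close>
definition zonal :: "nat \<Rightarrow> nat \<Rightarrow> 'a::euclidean_space \<Rightarrow> 'a \<Rightarrow> real" where
  "zonal n k x y =
     (let \<nu> = (real n - 1) / 2 in (real k + \<nu>) / \<nu> * gegenbauer \<nu> k (x \<bullet> y))"

definition sph_proj :: "nat \<Rightarrow> nat \<Rightarrow> ('a::euclidean_space \<Rightarrow> real) \<Rightarrow> 'a \<Rightarrow> real" where
  "sph_proj n k f x = (LINT y|sphere_measure. zonal n k x y * f y)"

definition cesaro_coeff :: "real \<Rightarrow> nat \<Rightarrow> real" where
  "cesaro_coeff \<delta> k = (real k + \<delta>) gchoose k"

definition cesaro_mean ::
  "nat \<Rightarrow> real \<Rightarrow> nat \<Rightarrow> ('a::euclidean_space \<Rightarrow> real) \<Rightarrow> 'a \<Rightarrow> real" where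
  "cesaro_mean n \<delta> N f x =
     (\<Sum>k=0..N. cesaro_coeff \<delta> (N - k) * sph_proj n k f x) / cesaro_coeff \<delta> N"

end

theory Submission
  imports Defs
begin

text \<open>
  The proof follows Kolmogorov's construction of divergent Fourier series in the form that Stein
  gave it in several variables: a discrete measure has unbounded means at almost every point,
  and integrable functions that imitate such measures are added up by a gliding hump argument.

  Write \<open>l = (n - 1) / 2\<close>, and let \<open>w\<close> be the point of the unit circle whose argument is the angle between
  \<open>x\<close> and \<open>y\<close>. At the critical order \<open>l\<close> the kernel of the \<open>N\<close>-th mean behaves like a pure oscillation
  \<open>2 Re (\<gamma> w\<^sup>N)\<close> with an amplitude \<open>|\<gamma>|\<close> of at least \<open>2\<^sup>-\<^sup>l |x - y|\<^sup>-\<^sup>n\<close>, which is just not integrable in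
  \<open>y\<close>. This is expressed by the averages \<open>abel_mean\<close> of the kernel against the
  sequences \<open>\<zeta>\<^sup>N\<close>: they are radial limits of the generating function
  (\<open>cesaro_kernel_fps\<close>), and they vanish unless \<open>\<zeta>\<close> is \<open>w\<close> or \<open>cnj w\<close>
  (\<open>abel_mean_kernel_off_spectrum\<close>, \<open>abel_mean_kernel_on_spectrum\<close>).

  If \<open>y\<^sub>1, \<dots>, y\<^sub>m\<close> are points for which the corresponding \<open>w\<^sub>1, \<dots>, w\<^sub>m\<close> are multiplicatively independent,
  then averaging against a Riesz product aligns the phases of all the kernels, so that the sum of the
  kernels with nonnegative weights reaches the weighted sum of the amplitudes
  (\<open>kernel_combination_large\<close>). Generic points are independent in this sense for almost every \<open>x\<close>
  (\<open>exists_generic_points\<close>). If in addition the weighted points are close to the uniform measure, then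
  the sum of the amplitudes is as large as desired, because \<open>|x - y|\<^sup>-\<^sup>n\<close> is not integrable
  (\<open>exists_generic_point_masses\<close>).

  Replacing point masses by small caps gives functions of norm at most \<open>1\<close> whose means are large outside a
  set of small measure (\<open>exists_large_function\<close>). Since the means
  of the terms chosen before need not be bounded, a pigeonhole argument over several multiples of the new
  function is used to avoid cancellation (\<open>exists_perturbation\<close>). The sum of a rapidly decreasing series of
  perturbations has the required property (\<open>exists_gliding_hump\<close>,
  \<open>exists_divergent_critical_means\<close>).
\<close>

section \<open>Generating functions of Gegenbauer polynomials and critical kernels\<close>

definition disc_series :: "(nat \<Rightarrow> complex) \<Rightarrow> (complex \<Rightarrow> complex) \<Rightarrow> bool" where
  "disc_series a F \<longleftrightarrow> (\<forall>z. norm z < 1 \<longrightarrow> (\<lambda>n. a n * z ^ n) sums F z)"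

lemma disc_series_abs_summable:
  assumes "disc_series a F" "norm z < 1"
  shows "summable (\<lambda>n. norm (a n * z ^ n))"
proof -
  \<comment> \<open>A power series converges absolutely at \<open>z\<close> if it converges at a point of larger modulus.\<close>
  obtain r where r: "norm z < r" "r < 1" using assms(2) dense by blast
  then have r0: "0 < r" using norm_ge_zero[of z] by linarith
  have "summable (\<lambda>n. a n * of_real r ^ n)"
    using assms(1) r r0 unfolding disc_series_def by (auto dest!: spec[of _ "of_real r"] simp: sums_iff)
  then show ?thesis
    by (rule powser_insidea) (use r r0 in auto)
qed

lemma disc_series_mult:
  assumes "disc_series (fps_nth A) F" "disc_series (fps_nth B) G"
  shows "disc_series (fps_nth (A * B)) (\<lambda>z. F z * G z)"
  unfolding disc_series_def
proof (intro allI impI)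
  fix z :: complex assume z: "norm z < 1"
  have "(\<lambda>k. \<Sum>i\<le>k. (fps_nth A i * z ^ i) * (fps_nth B (k - i) * z ^ (k - i))) sums
          ((\<Sum>k. fps_nth A k * z ^ k) * (\<Sum>k. fps_nth B k * z ^ k))"
    by (intro Cauchy_product_sums disc_series_abs_summable[OF assms(1) z]
          disc_series_abs_summable[OF assms(2) z])
  also have "(\<lambda>k. \<Sum>i\<le>k. (fps_nth A i * z ^ i) * (fps_nth B (k - i) * z ^ (k - i))) =
               (\<lambda>k. fps_nth (A * B) k * z ^ k)"
  proof
    fix k
    have "(fps_nth A i * z ^ i) * (fps_nth B (k - i) * z ^ (k - i)) =
            fps_nth A i * fps_nth B (k - i) * z ^ k" if "i \<le> k" for i
      using that by (simp add: power_add[of z i "k - i", symmetric] mult_ac)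
    then have "(\<Sum>i\<le>k. (fps_nth A i * z ^ i) * (fps_nth B (k - i) * z ^ (k - i))) =
                 (\<Sum>i\<le>k. fps_nth A i * fps_nth B (k - i) * z ^ k)"
      by (intro sum.cong) auto
    then show "(\<Sum>i\<le>k. (fps_nth A i * z ^ i) * (fps_nth B (k - i) * z ^ (k - i))) =
                 fps_nth (A * B) k * z ^ k"
      by (simp add: fps_mult_nth sum_distrib_right atLeast0AtMost)
  qed
  also have "(\<Sum>k. fps_nth A k * z ^ k) * (\<Sum>k. fps_nth B k * z ^ k) = F z * G z"
    using assms z unfolding disc_series_def by (simp add: sums_iff)
  finally show "(\<lambda>k. fps_nth (A * B) k * z ^ k) sums (F z * G z)" .
qed

text \<open>
  The binomial series \<open>(1 + c X)\<^sup>s\<close>.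
\<close>
definition linear_power :: "complex \<Rightarrow> complex \<Rightarrow> complex fps" where
  "linear_power c s = Abs_fps (\<lambda>k. (s gchoose k) * c ^ k)"

lemma linear_power_0 [simp]: "fps_nth (linear_power c s) 0 = 1"
  by (simp add: linear_power_def)

lemma disc_series_linear_power:
  assumes "norm c \<le> 1"
  shows "disc_series (fps_nth (linear_power c s)) (\<lambda>z. (1 + c * z) powr s)"
  unfolding disc_series_def
proof (intro allI impI)
  fix z :: complex assume "norm z < 1"
  moreover have "norm (c * z) \<le> 1 * norm z"
    unfolding norm_mult using assms by (intro mult_right_mono) auto
  ultimately have "norm (c * z) < 1" by simp
  from gen_binomial_complex[OF this, of s]
  show "(\<lambda>n. fps_nth (linear_power c s) n * z ^ n) sums (1 + c * z) powr s"
    by (simp add: linear_power_def power_mult_distrib mult.assoc)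
qed

lemma linear_power_plus_one:
  "(1 + fps_const c * fps_X) * linear_power c s = linear_power c (s + 1)"
proof (rule fps_ext)
  fix k show "fps_nth ((1 + fps_const c * fps_X) * linear_power c s) k
                = fps_nth (linear_power c (s + 1)) k"
  proof (cases k)
    case (Suc m)
    then show ?thesis
      using gbinomial_Suc_Suc[of s m] by (simp add: linear_power_def algebra_simps)
  qed (simp add: linear_power_def)
qed

lemma linear_power_deriv:
  "(1 + fps_const c * fps_X) * fps_deriv (linear_power c s) = fps_const (s * c) * linear_power c s"
proof (rule fps_ext)
  fix k show "fps_nth ((1 + fps_const c * fps_X) * fps_deriv (linear_power c s)) k
                = fps_nth (fps_const (s * c) * linear_power c s) k"
  proof (cases k)
    case 0
    then show ?thesis by (simp add: linear_power_def algebra_simps)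
  next
    case (Suc m)
    have "(of_nat (Suc k)) * (s gchoose Suc k) = (s - of_nat k) * (s gchoose k)"
      using gbinomial_mult_1[of s k] by (simp add: algebra_simps)
    then have "of_nat (Suc k) * (s gchoose Suc k) * c ^ Suc k = (s - of_nat k) * (s gchoose k) * c ^ Suc k"
      by simp
    then show ?thesis using Suc
      by (simp add: linear_power_def algebra_simps)
  qed
qed

lemma conjugate_linear_factors:
  assumes "norm w = 1"
  shows "(1 + fps_const (- w) * fps_X) * (1 + fps_const (- cnj w) * fps_X)
           = 1 - fps_const (2 * of_real (Re w)) * fps_X + fps_X ^ 2"
proof -
  have wv: "w * cnj w = 1" using assms complex_norm_square[of w] by simp
  have wv2: "w + cnj w = of_real (2 * Re w)" using complex_add_cnj[of w] by simp
  have "(1 + fps_const (- w) * fps_X) * (1 + fps_const (- cnj w) * fps_X)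
          = 1 - fps_const (w + cnj w) * fps_X + fps_const (w * cnj w) * fps_X^2"
    by (simp add: algebra_simps power2_eq_square flip: fps_const_mult fps_const_add)
  then show ?thesis using wv wv2 by simp
qed

text \<open>
  With \<open>w + cnj w = 2 t\<close> and \<open>w * cnj w = 1\<close>, the product \<open>H\<close> is \<open>(1 - 2 t X + X\<^sup>2)\<close> to the
  power \<open>- l\<close>. Each factor satisfies a first-order equation with linear coefficients, and Leibniz' rule adds the
  logarithmic derivatives.
\<close>
lemma gegenbauer_ode:
  fixes l :: real
  assumes w: "norm w = 1"
  defines "H \<equiv> linear_power (- w) (- of_real l) * linear_power (- cnj w) (- of_real l)"
  shows "(1 - fps_const (2 * of_real (Re w)) * fps_X + fps_X^2) * fps_deriv H =
      (fps_const (2 * of_real l * of_real (Re w)) - fps_const (2 * of_real l) * fps_X) * H"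
proof -
  let ?w = "1 + fps_const (-w) * fps_X" and ?v = "1 + fps_const (- cnj w) * fps_X"
  let ?l = "complex_of_real l" and ?t = "complex_of_real (Re w)"
  have wv: "w * cnj w = 1" using w complex_norm_square[of w] by simp
  have wv2: "w + cnj w = of_real (2 * Re w)" using complex_add_cnj[of w] by simp
  have leibniz: "W * V * (A * B' + A' * B) = (a * V + b * W) * (A * B)"
    if "W * A' = a * A" "V * B' = b * B" for W V A A' B B' a b :: "complex fps"
  proof -
    have "W * V * (A * B' + A' * B) = W * A * (V * B') + (W * A') * V * B"
      by (simp add: algebra_simps)
    also have "\<dots> = (a * V + b * W) * (A * B)" unfolding that by (simp add: algebra_simps)
    finally show ?thesis .
  qed
  have "?w * ?v * fps_deriv H = (fps_const (?l * w) * ?v + fps_const (?l * cnj w) * ?w) * H"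
    unfolding H_def fps_deriv_mult
    by (rule leibniz) (simp_all only: linear_power_deriv minus_mult_minus)
  also have "fps_const (?l * w) * ?v + fps_const (?l * cnj w) * ?w =
      fps_const (?l * (w + cnj w)) - fps_const (2 * ?l * (w * cnj w)) * fps_X"
    by (simp add: algebra_simps flip: fps_const_mult fps_const_add fps_const_minus)
  also have "\<dots> = fps_const (2 * ?l * ?t) - fps_const (2 * ?l) * fps_X"
    using wv wv2 by (simp add: algebra_simps)
  finally show ?thesis
    unfolding conjugate_linear_factors[OF w] .
qed

text \<open>
  Comparing coefficients in the differential equation gives exactly the three-term recurrence.
\<close>
lemma gegenbauer_fps:
  assumes w: "norm w = 1" and t: "t = Re w"
  shows "Abs_fps (\<lambda>k. complex_of_real (gegenbauer l k t))
           = linear_power (- w) (- of_real l) * linear_power (- cnj w) (- of_real l)"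
proof -
  define H where "H = linear_power (- w) (- of_real l) * linear_power (- cnj w) (- of_real l)"
  let ?l = "complex_of_real l" and ?t = "complex_of_real t"
  note ode = gegenbauer_ode[OF w, of l, folded H_def, folded t]
  have h0: "fps_nth H 0 = 1" by (simp add: H_def)
  have h1: "fps_nth H (Suc 0) = 2 * ?l * ?t"
    using arg_cong[OF ode, of "\<lambda>F. fps_nth F 0"] h0 by (simp add: power2_eq_square algebra_simps)
  have rec: "(of_nat k + 2) * fps_nth H (Suc (Suc k)) =
      2 * (of_nat k + 1 + ?l) * ?t * fps_nth H (Suc k) - (of_nat k + 2 * ?l) * fps_nth H k" for k
  proof -
    have "fps_nth ((1 - fps_const (2 * ?t) * fps_X + fps_X^2) * fps_deriv H) (Suc k) =
       fps_nth ((fps_const (2 * ?l * ?t) - fps_const (2 * ?l) * fps_X) * H) (Suc k)"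
      using ode by simp
    then show ?thesis
      by (cases k) (simp_all add: power2_eq_square algebra_simps)
  qed
  have "fps_nth H k = of_real (gegenbauer l k t) \<and>
        fps_nth H (Suc k) = of_real (gegenbauer l (Suc k) t)" for k
  proof (induction k)
    case (Suc k)
    have "(of_nat k + 2 :: complex) \<noteq> 0"
      by (metis add_2_eq_Suc' nat.distinct(1) of_nat_add of_nat_eq_0_iff of_nat_numeral)
    then have "fps_nth H (Suc (Suc k)) = (2 * (of_nat k + 1 + ?l) * ?t * fps_nth H (Suc k)
                 - (of_nat k + 2 * ?l) * fps_nth H k) / (of_nat k + 2)"
      using rec[of k] by (simp add: field_simps)
    then show ?case using Suc by simp
  qed (use h0 h1 in auto)
  then show ?thesis unfolding H_def[symmetric] by (intro fps_ext) simp
qed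

text \<open>
  The parameter \<open>l\<close> is both the Gegenbauer index and the order of the Cesaro mean: this is the
  critical case, where both equal \<open>(n - 1) / 2\<close> on the \<open>n\<close>-sphere.
\<close>
definition cesaro_kernel :: "real \<Rightarrow> nat \<Rightarrow> real \<Rightarrow> real" where
  "cesaro_kernel l N t =
     (\<Sum>k=0..N. cesaro_coeff l (N - k) * ((real k + l) / l * gegenbauer l k t)) / cesaro_coeff l N"

lemma cesaro_coeff_pos:
  assumes "0 < l" shows "0 < cesaro_coeff l N"
  unfolding cesaro_coeff_def gbinomial_prod_rev
  using assms by (intro divide_pos_pos prod_pos) auto

lemma cesaro_coeff_linear_power:
  "fps_nth (linear_power (- 1) (- of_real (l + 1))) N = complex_of_real (cesaro_coeff l N)"
proof -
  have g: "complex_of_real (a gchoose N) = of_real a gchoose N" for a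
    by (simp add: gbinomial_prod_rev)
  show ?thesis
    using gbinomial_minus[of "complex_of_real (l + 1)" N]
    by (simp add: linear_power_def cesaro_coeff_def g algebra_simps flip: power_mult_distrib)
qed

lemma linear_power_of_0 [simp]: "linear_power c 0 = 1"
  by (rule fps_ext) (auto simp: linear_power_def gbinomial_0_left)

text \<open>
  The generating function of the kernels, weighted by \<open>cesaro_coeff\<close>, is
  \<open>(1 + X) (1 - X)\<^sup>-\<^sup>l (1 - w X)\<^sup>-\<^sup>l\<^sup>-\<^sup>1 (1 - cnj w X)\<^sup>-\<^sup>l\<^sup>-\<^sup>1\<close>. The operator \<open>H \<mapsto> H + X H' / l\<close> inserts
  the factors \<open>(k + l) / l\<close> and, by the differential equation, turns \<open>(1 - 2 t X + X\<^sup>2)\<^sup>-\<^sup>l\<close> into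
  \<open>(1 - X\<^sup>2) (1 - 2 t X + X\<^sup>2)\<^sup>-\<^sup>l\<^sup>-\<^sup>1\<close>; summation with the weights \<open>cesaro_coeff l (N - k)\<close> multiplies
  by \<open>(1 - X)\<^sup>-\<^sup>l\<^sup>-\<^sup>1\<close>. Of the singularities on the unit circle, those at \<open>w\<close> and \<open>cnj w\<close> have the
  order \<open>l + 1\<close> and the one at \<open>1\<close> has the smaller order \<open>l\<close>. This is what is special about the
  critical order: the kernel oscillates with the frequencies \<open>w\<close> and \<open>cnj w\<close> without decaying.
\<close>
lemma cesaro_kernel_fps:
  assumes l: "0 < l" and w: "norm w = 1" and t: "t = Re w"
  shows "Abs_fps (\<lambda>N. complex_of_real (cesaro_coeff l N * cesaro_kernel l N t)) =
     linear_power 1 1 * linear_power (- 1) (- of_real l) *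
     linear_power (- w) (- of_real (l + 1)) * linear_power (- cnj w) (- of_real (l + 1))"
proof -
  let ?l = "complex_of_real l" and ?t = "complex_of_real t"
  let ?s = "complex_of_real (l + 1)"
  define H where "H = linear_power (- w) (- ?l) * linear_power (- cnj w) (- ?l)"
  define H1 where "H1 = linear_power (- w) (- ?s) * linear_power (- cnj w) (- ?s)"
  define P where "P = 1 - fps_const (2 * ?t) * fps_X + fps_X ^ 2"
  define D where "D = Abs_fps (\<lambda>k. complex_of_real ((real k + l) / l * gegenbauer l k t))"
  note ode = gegenbauer_ode[OF w, of l, folded H_def, folded t, folded P_def]
  have D: "D = H + fps_const (1 / ?l) * (fps_X * fps_deriv H)"
  proof (rule fps_ext)
    fix k
    have "fps_nth H k = of_real (gegenbauer l k t)"
      unfolding H_def gegenbauer_fps[OF w t, symmetric] by simp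
    then show "fps_nth D k = fps_nth (H + fps_const (1 / ?l) * (fps_X * fps_deriv H)) k"
      using l by (cases k) (simp_all add: D_def field_simps)
  qed
  have "P * D = P * H + fps_const (1 / ?l) * (fps_X * (P * fps_deriv H))"
    unfolding D by (simp only: algebra_simps)
  also have "fps_const (1 / ?l) * (fps_X * (P * fps_deriv H))
      = (fps_const (1 / ?l * (2 * ?l * ?t)) * fps_X - fps_const (1 / ?l * (2 * ?l)) * fps_X^2) * H"
  proof -
    have "fps_const c * (fps_X * ((fps_const a - fps_const b * fps_X) * H))
            = (fps_const (c * a) * fps_X - fps_const (c * b) * fps_X^2) * H" for a b c
      by (simp only: fps_const_mult[symmetric] power2_eq_square algebra_simps)
    then show ?thesis unfolding ode .
  qed
  also have "1 / ?l * (2 * ?l * ?t) = 2 * ?t" using l by simp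
  also have "1 / ?l * (2 * ?l) = 2" using l by simp
  also have "P * H + (fps_const (2 * ?t) * fps_X - fps_const 2 * fps_X^2) * H = (1 - fps_X^2) * H"
  proof -
    have "P * H + (a - (1 + 1) * fps_X^2) * H = (1 - fps_X^2) * H"
      if "P = 1 - a + fps_X^2" for a unfolding that by (simp add: algebra_simps)
    moreover have "(fps_const 2 :: complex fps) = 1 + 1" by (metis fps_const_1_eq_1 fps_const_add one_add_one)
    ultimately show ?thesis using P_def by metis
  qed
  also have "H = P * H1"
  proof -
    have s: "- ?l = - ?s + 1" by simp
    have "H = ((1 + fps_const (- w) * fps_X) * (1 + fps_const (- cnj w) * fps_X)) * H1"
      unfolding H_def H1_def s linear_power_plus_one[symmetric] by (simp only: mult_ac)
    then show ?thesis unfolding conjugate_linear_factors[OF w] P_def t .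
  qed
  finally have "P * D = P * ((1 - fps_X^2) * H1)" by (simp only: mult_ac)
  moreover have "P \<noteq> 0"
  proof -
    have "fps_nth P 0 = 1" by (simp add: P_def)
    then show ?thesis by auto
  qed
  ultimately have D1: "D = (1 - fps_X^2) * H1" by simp
  have "Abs_fps (\<lambda>N. complex_of_real (cesaro_coeff l N * cesaro_kernel l N t)) =
          D * linear_power (- 1) (- ?s)"
  proof (rule fps_ext)
    fix N
    have "fps_nth (D * linear_power (- 1) (- ?s)) N =
        of_real (\<Sum>k=0..N. (real k + l) / l * gegenbauer l k t * cesaro_coeff l (N - k))"
      unfolding fps_mult_nth cesaro_coeff_linear_power by (simp add: D_def)
    also have "(\<Sum>k=0..N. (real k + l) / l * gegenbauer l k t * cesaro_coeff l (N - k)) =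
        cesaro_coeff l N * cesaro_kernel l N t"
      using cesaro_coeff_pos[OF l, of N] by (simp add: cesaro_kernel_def mult_ac)
    finally show "fps_nth (Abs_fps (\<lambda>N. complex_of_real (cesaro_coeff l N * cesaro_kernel l N t))) N =
        fps_nth (D * linear_power (- 1) (- ?s)) N" by simp
  qed
  also have "\<dots> = (1 + fps_X) * ((1 + fps_const (- 1) * fps_X) * linear_power (- 1) (- ?s)) * H1"
    unfolding D1 by (simp add: algebra_simps power2_eq_square flip: fps_const_neg)
  also have "(1 + fps_const (- 1) * fps_X) * linear_power (- 1) (- ?s) = linear_power (- 1) (- ?l)"
    unfolding linear_power_plus_one by simp
  also have "1 + fps_X = linear_power 1 1"
    using linear_power_plus_one[of 1 0] by simp
  finally show ?thesis by (simp add: H1_def mult.assoc)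
qed

lemma cesaro_kernel_sums:
  assumes l: "0 < l" and w: "norm w = 1" and t: "t = Re w" and z: "norm z < 1"
  shows "(\<lambda>N. complex_of_real (cesaro_coeff l N * cesaro_kernel l N t) * z ^ N) sums
     ((1 + z) * (1 - z) powr (- of_real l) * (1 - w * z) powr (- of_real (l + 1)) *
      (1 - cnj w * z) powr (- of_real (l + 1)))"
proof -
  have "disc_series (fps_nth (linear_power 1 1 * linear_power (- 1) (- of_real l) *
     linear_power (- w) (- of_real (l + 1)) * linear_power (- cnj w) (- of_real (l + 1))))
     (\<lambda>z. (1 + 1 * z) powr 1 * (1 + (- 1) * z) powr (- of_real l) *
      (1 + (- w) * z) powr (- of_real (l + 1)) * (1 + (- cnj w) * z) powr (- of_real (l + 1)))"
    by (intro disc_series_mult disc_series_linear_power) (use w in auto)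
  then show ?thesis
    using z unfolding disc_series_def cesaro_kernel_fps[OF l w t, symmetric]
    by (auto dest!: spec[of _ z])
qed

lemma cesaro_coeff_sums:
  assumes "norm z < 1"
  shows "(\<lambda>N. complex_of_real (cesaro_coeff l N) * z ^ N) sums (1 - z) powr (- of_real (l + 1))"
  using disc_series_linear_power[of "- 1" "- of_real (l + 1)"] assms
  unfolding disc_series_def cesaro_coeff_linear_power by (auto dest!: spec[of _ z])

section \<open>Abel averages and the spectrum of the critical kernel\<close>

text \<open>
  The numbers \<open>(1 - r)\<^sup>l\<^sup>+\<^sup>1 cesaro_coeff l N r\<^sup>N\<close> are probability weights on the indices \<open>N\<close>, by the
  binomial series, and for \<open>r \<rightarrow> 1\<close> their mass escapes to infinity. So \<open>L\<close> is an asymptotic average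
  of \<open>u\<close>. It can be read off from the radial behaviour of the generating function of
  \<open>cesaro_coeff l N * u N\<close> near the unit circle.
\<close>
definition abel_mean :: "real \<Rightarrow> (nat \<Rightarrow> complex) \<Rightarrow> complex \<Rightarrow> bool" where
  "abel_mean l u L \<longleftrightarrow>
     (\<forall>r. 0 < r \<and> r < 1 \<longrightarrow> summable (\<lambda>N. of_real (cesaro_coeff l N * r ^ N) * u N)) \<and>
     ((\<lambda>r. of_real ((1 - r) powr (l + 1)) * (\<Sum>N. of_real (cesaro_coeff l N * r ^ N) * u N))
        \<longlongrightarrow> L) (at_left 1)"

lemma eventually_at_left_1: "\<forall>\<^sub>F r in at_left (1::real). 0 < r \<and> r < 1"
  using eventually_at_left_real[of 0 1] by (auto elim: eventually_mono)

lemma abel_meanI: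
  assumes "\<And>r. 0 < r \<Longrightarrow> r < 1 \<Longrightarrow> (\<lambda>N. of_real (cesaro_coeff l N * r ^ N) * u N) sums S r"
    and "((\<lambda>r. of_real ((1 - r) powr (l + 1)) * S r) \<longlongrightarrow> L) (at_left 1)"
  shows "abel_mean l u L"
  unfolding abel_mean_def
proof (intro conjI allI impI)
  show "((\<lambda>r. of_real ((1 - r) powr (l + 1)) * (\<Sum>N. of_real (cesaro_coeff l N * r ^ N) * u N))
        \<longlongrightarrow> L) (at_left 1)"
    by (rule Lim_transform_eventually[OF assms(2)], rule eventually_mono[OF eventually_at_left_1])
       (use assms(1) in \<open>auto simp: sums_iff\<close>)
qed (use assms(1) in \<open>auto simp: sums_iff\<close>)

lemma abel_mean_add:
  assumes "abel_mean l u L" "abel_mean l v M"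
  shows "abel_mean l (\<lambda>N. u N + v N) (L + M)"
proof (rule abel_meanI)
  show "((\<lambda>r. of_real ((1 - r) powr (l + 1)) * 
      ((\<Sum>N. of_real (cesaro_coeff l N * r ^ N) * u N) + (\<Sum>N. of_real (cesaro_coeff l N * r ^ N) * v N)))
      \<longlongrightarrow> L + M) (at_left 1)"
    using assms unfolding abel_mean_def distrib_left by (intro tendsto_add) auto
  fix r :: real assume "0 < r" "r < 1"
  then show "(\<lambda>N. of_real (cesaro_coeff l N * r ^ N) * (u N + v N)) sums
     ((\<Sum>N. of_real (cesaro_coeff l N * r ^ N) * u N) + (\<Sum>N. of_real (cesaro_coeff l N * r ^ N) * v N))"
    using assms unfolding abel_mean_def distrib_left by (intro sums_add) auto
qed

lemma abel_mean_cmult: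
  assumes "abel_mean l u L"
  shows "abel_mean l (\<lambda>N. c * u N) (c * L)"
proof (rule abel_meanI)
  have "((\<lambda>r. c * (of_real ((1 - r) powr (l + 1)) * (\<Sum>N. of_real (cesaro_coeff l N * r ^ N) * u N)))
      \<longlongrightarrow> c * L) (at_left 1)"
    using assms unfolding abel_mean_def by (intro tendsto_mult_left) auto
  then show "((\<lambda>r. of_real ((1 - r) powr (l + 1)) * 
      (c * (\<Sum>N. of_real (cesaro_coeff l N * r ^ N) * u N))) \<longlongrightarrow> c * L) (at_left 1)"
    by (simp only: mult_ac)
  fix r :: real assume "0 < r" "r < 1"
  then have "(\<lambda>N. c * (of_real (cesaro_coeff l N * r ^ N) * u N)) sums
     (c * (\<Sum>N. of_real (cesaro_coeff l N * r ^ N) * u N))"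
    using assms unfolding abel_mean_def by (intro sums_mult) auto
  then show "(\<lambda>N. of_real (cesaro_coeff l N * r ^ N) * (c * u N)) sums
     (c * (\<Sum>N. of_real (cesaro_coeff l N * r ^ N) * u N))"
    by (simp only: mult_ac)
qed

lemma abel_mean_zero: "abel_mean l (\<lambda>N. 0) 0"
  by (rule abel_meanI[where S = "\<lambda>_. 0"]) auto

lemma abel_mean_sum:
  assumes "\<And>i. i \<in> I \<Longrightarrow> abel_mean l (u i) (L i)"
  shows "abel_mean l (\<lambda>N. \<Sum>i\<in>I. u i N) (\<Sum>i\<in>I. L i)"
  using assms by (induction I rule: infinite_finite_induct) (auto intro: abel_mean_add abel_mean_zero)

lemma abel_mean_cnj:
  assumes "abel_mean l u L"
  shows "abel_mean l (\<lambda>N. cnj (u N)) (cnj L)"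
proof (rule abel_meanI)
  have "((\<lambda>r. cnj (of_real ((1 - r) powr (l + 1)) * (\<Sum>N. of_real (cesaro_coeff l N * r ^ N) * u N)))
      \<longlongrightarrow> cnj L) (at_left 1)"
    using assms unfolding abel_mean_def by (intro tendsto_cnj) auto
  then show "((\<lambda>r. of_real ((1 - r) powr (l + 1)) * 
      cnj (\<Sum>N. of_real (cesaro_coeff l N * r ^ N) * u N)) \<longlongrightarrow> cnj L) (at_left 1)"
    by simp
  fix r :: real assume "0 < r" "r < 1"
  then have "(\<lambda>N. cnj (of_real (cesaro_coeff l N * r ^ N) * u N)) sums
     (cnj (\<Sum>N. of_real (cesaro_coeff l N * r ^ N) * u N))"
    using assms unfolding abel_mean_def sums_cnj by auto
  then show "(\<lambda>N. of_real (cesaro_coeff l N * r ^ N) * cnj (u N)) sums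
     (cnj (\<Sum>N. of_real (cesaro_coeff l N * r ^ N) * u N))"
    by simp
qed

lemma tendsto_one_minus_powr:
  assumes "0 < a" shows "((\<lambda>r. complex_of_real ((1 - r) powr a)) \<longlongrightarrow> 0) (at_left 1)"
proof -
  have "((\<lambda>r. 1 - r) \<longlongrightarrow> 1 - 1) (at_left (1::real))" by (intro tendsto_intros)
  then have "((\<lambda>r. (1 - r) powr a) \<longlongrightarrow> 0 powr a) (at_left (1::real))"
    using assms
    by (intro tendsto_powr2 tendsto_const)
       (auto intro: eventually_mono[OF eventually_at_left_1])
  then have "((\<lambda>r. (1 - r) powr a) \<longlongrightarrow> 0) (at_left (1::real))" using assms by simp
  from tendsto_of_real[OF this] show ?thesis by simp
qed

lemma tendsto_one_minus_mult_powr: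
  assumes "norm c = 1" "c \<noteq> 1"
  shows "((\<lambda>r. (1 - c * complex_of_real r) powr p) \<longlongrightarrow> (1 - c) powr p) (at_left 1)"
proof -
  have "Re c < 1"
  proof (rule ccontr)
    assume "\<not> Re c < 1"
    then have "Re c = 1" using complex_Re_le_cmod[of c] assms by simp
    moreover then have "Im c = 0" using cmod_power2[of c] assms by simp
    ultimately show False using assms by (auto simp: complex_eq_iff)
  qed
  then have "1 - c \<notin> \<real>\<^sub>\<le>\<^sub>0" by (auto simp: complex_nonpos_Reals_iff)
  moreover have "((\<lambda>r. 1 - c * complex_of_real r) \<longlongrightarrow> 1 - c * of_real 1) (at_left 1)"
    by (intro tendsto_intros)
  ultimately show ?thesis by (intro tendsto_powr_complex tendsto_const) auto
qed

lemma one_minus_powr_cancel: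
  assumes "r < 1"
  shows "complex_of_real ((1 - r) powr a) * (1 - of_real r) powr (- of_real b)
           = of_real ((1 - r) powr (a - b))"
proof -
  have "(1 - complex_of_real r) powr (- of_real b) = of_real ((1 - r) powr (- b))"
    using assms powr_of_real[of "1 - r" "- b"] by simp
  then have "complex_of_real ((1 - r) powr a) * (1 - of_real r) powr (- of_real b)
      = of_real ((1 - r) powr a * (1 - r) powr (- b))" by simp
  then show ?thesis by (simp only: powr_add[symmetric] add_uminus_conv_diff)
qed

lemma tendsto_one_minus_powr_cancel:
  "((\<lambda>r. of_real ((1 - r) powr a) * (1 - of_real r) powr (- complex_of_real a)) \<longlongrightarrow> 1) (at_left 1)"
proof (rule tendsto_eventually, rule eventually_mono[OF eventually_at_left_1])
  fix r :: real assume "0 < r \<and> r < 1"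
  then show "of_real ((1 - r) powr a) * (1 - of_real r) powr (- complex_of_real a) = 1"
    by (subst one_minus_powr_cancel) auto
qed

lemma abel_mean_one: "abel_mean l (\<lambda>N. 1) 1"
proof (rule abel_meanI)
  fix r :: real assume "0 < r" "r < 1"
  then show "(\<lambda>N. of_real (cesaro_coeff l N * r ^ N) * 1) sums (1 - complex_of_real r) powr (- of_real (l + 1))"
    using cesaro_coeff_sums[of "of_real r" l] by simp
next
  show "((\<lambda>r. of_real ((1 - r) powr (l + 1)) * (1 - complex_of_real r) powr (- of_real (l + 1)))
      \<longlongrightarrow> 1) (at_left 1)"
    by (rule tendsto_one_minus_powr_cancel)
qed

lemma abel_mean_power:
  assumes "0 < l" "norm \<zeta> = 1" "\<zeta> \<noteq> 1"
  shows "abel_mean l (\<lambda>N. \<zeta> ^ N) 0"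
proof (rule abel_meanI)
  fix r :: real assume "0 < r" "r < 1"
  then show "(\<lambda>N. of_real (cesaro_coeff l N * r ^ N) * \<zeta> ^ N) sums
        (1 - \<zeta> * of_real r) powr (- of_real (l + 1))"
    using cesaro_coeff_sums[of "\<zeta> * of_real r" l] assms
    by (simp add: norm_mult power_mult_distrib mult_ac)
next
  show "((\<lambda>r. of_real ((1 - r) powr (l + 1)) * (1 - \<zeta> * complex_of_real r) powr (- of_real (l + 1)))
      \<longlongrightarrow> 0) (at_left 1)"
    using tendsto_mult[OF tendsto_one_minus_powr[of "l + 1"]
        tendsto_one_minus_mult_powr[OF assms(2,3), of "- of_real (l + 1)"]] assms(1) by simp
qed

lemma abel_mean_kernelI:
  assumes l: "0 < l" and w: "norm w = 1" and t: "t = Re w" and \<zeta>: "norm \<zeta> = 1"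
   and lim: "((\<lambda>r. of_real ((1 - r) powr (l + 1)) * ((1 + \<zeta> * of_real r) *
      (1 - \<zeta> * of_real r) powr (- of_real l) *
      (1 - w * \<zeta> * of_real r) powr (- of_real (l + 1)) *
      (1 - cnj w * \<zeta> * of_real r) powr (- of_real (l + 1)))) \<longlongrightarrow> L) (at_left 1)"
  shows "abel_mean l (\<lambda>N. of_real (cesaro_kernel l N t) * \<zeta> ^ N) L"
proof (rule abel_meanI[OF _ lim])
  fix r :: real assume "0 < r" "r < 1"
  then show "(\<lambda>N. of_real (cesaro_coeff l N * r ^ N) * (of_real (cesaro_kernel l N t) * \<zeta> ^ N)) sums
     ((1 + \<zeta> * of_real r) * (1 - \<zeta> * of_real r) powr (- of_real l) *
      (1 - w * \<zeta> * of_real r) powr (- of_real (l + 1)) *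
      (1 - cnj w * \<zeta> * of_real r) powr (- of_real (l + 1)))"
    using cesaro_kernel_sums[OF l w t, of "\<zeta> * of_real r"] \<zeta>
    by (simp add: norm_mult power_mult_distrib mult_ac)
qed

text \<open>
  Away from \<open>w\<close> and \<open>cnj w\<close>, the generating function grows radially more slowly than
  \<open>(1 - r)\<^sup>-\<^sup>l\<^sup>-\<^sup>1\<close>; the only other possible singularity is the one of order \<open>l\<close> at \<open>1\<close>.
\<close>
lemma abel_mean_kernel_off_spectrum:
  assumes l: "0 < l" and w: "norm w = 1" and t: "t = Re w" and \<zeta>: "norm \<zeta> = 1"
   and ne: "\<zeta> \<noteq> w" "\<zeta> \<noteq> cnj w"
  shows "abel_mean l (\<lambda>N. of_real (cesaro_kernel l N t) * \<zeta> ^ N) 0"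
proof (rule abel_mean_kernelI[OF l w t \<zeta>])
  have wv: "w * cnj w = 1" using w complex_norm_square[of w] by simp
  have n1: "w * \<zeta> \<noteq> 1"
  proof
    assume "w * \<zeta> = 1"
    moreover have "cnj w * (w * \<zeta>) = (w * cnj w) * \<zeta>" by (simp only: mult_ac)
    ultimately show False using wv ne by simp
  qed
  have n2: "cnj w * \<zeta> \<noteq> 1"
  proof
    assume "cnj w * \<zeta> = 1"
    moreover have "w * (cnj w * \<zeta>) = (w * cnj w) * \<zeta>" by (simp only: mult_ac)
    ultimately show False using wv ne by simp
  qed
  have nn: "norm (w * \<zeta>) = 1" "norm (cnj w * \<zeta>) = 1" using w \<zeta> by (auto simp: norm_mult)
  note lim = tendsto_mult[OF tendsto_one_minus_mult_powr[OF nn(1) n1, of "- of_real (l + 1)"]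
       tendsto_one_minus_mult_powr[OF nn(2) n2, of "- of_real (l + 1)"]]
  have lim1: "((\<lambda>r. 1 + \<zeta> * of_real r) \<longlongrightarrow> 1 + \<zeta> * of_real 1) (at_left (1::real))"
    by (intro tendsto_intros)
  show "((\<lambda>r. of_real ((1 - r) powr (l + 1)) * ((1 + \<zeta> * of_real r) *
      (1 - \<zeta> * of_real r) powr (- of_real l) *
      (1 - w * \<zeta> * of_real r) powr (- of_real (l + 1)) *
      (1 - cnj w * \<zeta> * of_real r) powr (- of_real (l + 1)))) \<longlongrightarrow> 0) (at_left 1)"
  proof (cases "\<zeta> = 1")
    case False
    from tendsto_mult[OF tendsto_one_minus_powr[of "l + 1"]
       tendsto_mult[OF tendsto_mult[OF lim1 tendsto_one_minus_mult_powr[OF \<zeta> False]] lim]] l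
    show ?thesis by (simp add: mult.assoc)
  next
    case True
    have "((\<lambda>r. of_real ((1 - r) powr (l + 1)) * (1 - of_real r) powr (- complex_of_real l)) \<longlongrightarrow> 0) (at_left 1)"
    proof (rule Lim_transform_eventually[OF tendsto_one_minus_powr[of 1]])
      show "\<forall>\<^sub>F r in at_left 1. complex_of_real ((1 - r) powr 1) =
          of_real ((1 - r) powr (l + 1)) * (1 - of_real r) powr (- complex_of_real l)"
      proof (rule eventually_mono[OF eventually_at_left_1])
        fix r :: real assume "0 < r \<and> r < 1"
        then show "complex_of_real ((1 - r) powr 1) =
          of_real ((1 - r) powr (l + 1)) * (1 - of_real r) powr (- complex_of_real l)"
          by (subst one_minus_powr_cancel) auto
      qed
    qed simp
    from tendsto_mult[OF this tendsto_mult[OF lim1 lim]] True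
    show ?thesis by (simp add: mult_ac)
  qed
qed

text \<open>
  In the direction \<open>cnj w\<close> the factor \<open>(1 - w z)\<^sup>-\<^sup>l\<^sup>-\<^sup>1\<close> cancels the weight \<open>(1 - r)\<^sup>l\<^sup>+\<^sup>1\<close>, and the
  value of the remaining factors at \<open>cnj w\<close> is the limit. Its modulus is
  \<open>|1 - w|\<^sup>-\<^sup>2\<^sup>l\<^sup>-\<^sup>1 |1 + w|\<^sup>-\<^sup>l\<close>. For \<open>2 l + 1 = n\<close> this singularity at \<open>w = 1\<close> is just not integrable on
  the \<open>n\<close>-sphere, which is the source of the divergence.
\<close>
lemma abel_mean_kernel_on_spectrum:
  assumes l: "0 < l" and w: "norm w = 1" and t: "t = Re w" and w2: "w\<^sup>2 \<noteq> 1"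
  shows "\<exists>\<gamma>. abel_mean l (\<lambda>N. of_real (cesaro_kernel l N t) * cnj w ^ N) \<gamma> \<and>
             abel_mean l (\<lambda>N. of_real (cesaro_kernel l N t) * w ^ N) (cnj \<gamma>) \<and>
             2 powr (- l) * norm (1 - w) powr (- (2 * l + 1)) \<le> norm \<gamma>"
proof -
  \<comment> \<open>The factors of the generating function at \<open>cnj w\<close>, without the singular one.\<close>
  define \<gamma> where "\<gamma> = (1 + cnj w) * (1 - cnj w) powr (- of_real l) *
                     (1 - cnj w * cnj w) powr (- of_real (l + 1))"
  have wv: "w * cnj w = 1" using w complex_norm_square[of w] by simp
  have ne: "cnj w \<noteq> 1" "cnj w * cnj w \<noteq> 1"
    using w2 by (auto simp: power2_eq_square simp flip: complex_cnj_mult)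
  have nn: "norm (cnj w) = 1" "norm (cnj w * cnj w) = 1" using w by (auto simp: norm_mult)
  have lim1: "((\<lambda>r. 1 + cnj w * of_real r) \<longlongrightarrow> 1 + cnj w * of_real 1) (at_left (1::real))"
    by (intro tendsto_intros)
  have lim2: "((\<lambda>r. of_real ((1 - r) powr (l + 1)) * (1 - of_real r) powr (- complex_of_real (l + 1)))
      \<longlongrightarrow> 1) (at_left 1)"
    by (rule tendsto_one_minus_powr_cancel)
  have 1: "abel_mean l (\<lambda>N. of_real (cesaro_kernel l N t) * cnj w ^ N) \<gamma>"
  proof (rule abel_mean_kernelI[OF l w t nn(1)])
    from tendsto_mult[OF lim2 tendsto_mult[OF tendsto_mult[OF lim1 
          tendsto_one_minus_mult_powr[OF nn(1) ne(1), of "- of_real l"]]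
          tendsto_one_minus_mult_powr[OF nn(2) ne(2), of "- of_real (l + 1)"]]]
    show "((\<lambda>r. of_real ((1 - r) powr (l + 1)) * ((1 + cnj w * of_real r) *
      (1 - cnj w * of_real r) powr (- of_real l) *
      (1 - w * cnj w * of_real r) powr (- of_real (l + 1)) *
      (1 - cnj w * cnj w * of_real r) powr (- of_real (l + 1)))) \<longlongrightarrow> \<gamma>) (at_left 1)"
      unfolding wv \<gamma>_def by (simp add: mult_ac)
  qed
  from abel_mean_cnj[OF 1]
  have 2: "abel_mean l (\<lambda>N. of_real (cesaro_kernel l N t) * w ^ N) (cnj \<gamma>)" by simp
  have w1: "w \<noteq> 1" "w \<noteq> - 1" using w2 by auto
  have p: "norm (1 - w) > 0" "norm (1 + w) > 0"
    using w1 by (auto simp: add_eq_0_iff)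
  have "norm (1 + w) \<le> 2" using norm_triangle_ineq[of 1 w] w by simp
  have c: "norm (1 + cnj w) = norm (1 + w)" "norm (1 - cnj w) = norm (1 - w)"
     using complex_mod_cnj[of "1 + w"] complex_mod_cnj[of "1 - w"] by simp_all
  have "1 - cnj w * cnj w = (1 - cnj w) * (1 + cnj w)" by (simp add: algebra_simps)
  then have n2: "norm (1 - cnj w * cnj w) = norm (1 - w) * norm (1 + w)"
    by (simp add: norm_mult c)
  have "norm \<gamma> = norm (1 + w) * norm (1 - w) powr (- l) * (norm (1 - w) * norm (1 + w)) powr (- (l + 1))"
    unfolding \<gamma>_def norm_mult n2[symmetric] c
    using norm_powr_real_powr'[of "- of_real l" "1 - cnj w"]
      norm_powr_real_powr'[of "- of_real (l + 1)" "1 - cnj w * cnj w"] by (simp add: c)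
  also have "\<dots> = norm (1 - w) powr (- (2 * l + 1)) * norm (1 + w) powr (- l)"
  proof -
    have "norm (1 + w) = norm (1 + w) powr 1" using p by simp
    then have "norm (1 + w) * norm (1 - w) powr (- l) * (norm (1 - w) * norm (1 + w)) powr (- (l + 1)) =
       (norm (1 - w) powr (- l) * norm (1 - w) powr (- (l + 1))) *
       (norm (1 + w) powr 1 * norm (1 + w) powr (- (l + 1)))"
      using p by (simp add: powr_mult mult_ac)
    also have "\<dots> = norm (1 - w) powr (- (2 * l + 1)) * norm (1 + w) powr (- l)"
      unfolding powr_add[symmetric] by (simp add: algebra_simps)
    finally show ?thesis .
  qed
  also have "\<dots> \<ge> norm (1 - w) powr (- (2 * l + 1)) * 2 powr (- l)"
    using p \<open>norm (1 + w) \<le> 2\<close> l by (intro mult_left_mono powr_mono2') auto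
  finally show ?thesis using 1 2 by (auto simp: mult.commute)
qed

section \<open>Riesz products over independent points of the unit circle\<close>

lemma abel_mean_finite_support: "0 < l \<Longrightarrow> abel_mean l (\<lambda>N. if N < n then u N else 0) 0"
proof (rule abel_meanI)
  fix r :: real
  have "(\<lambda>N. of_real (cesaro_coeff l N * r ^ N) * (if N < n then u N else 0)) sums
     (\<Sum>N<n. of_real (cesaro_coeff l N * r ^ N) * (if N < n then u N else 0))"
    by (rule sums_finite) auto
  then show "(\<lambda>N. of_real (cesaro_coeff l N * r ^ N) * (if N < n then u N else 0)) sums
     (\<Sum>N<n. of_real (cesaro_coeff l N * r ^ N) * u N)"
    by simp
next
  assume "0 < l"
  moreover have "((\<lambda>r. \<Sum>N<n. of_real (cesaro_coeff l N * r ^ N) * u N) \<longlongrightarrow>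
      (\<Sum>N<n. of_real (cesaro_coeff l N * 1 ^ N) * u N)) (at_left 1)"
    by (intro tendsto_intros)
  ultimately show "((\<lambda>r. of_real ((1 - r) powr (l + 1)) * (\<Sum>N<n. of_real (cesaro_coeff l N * r ^ N) * u N))
      \<longlongrightarrow> 0) (at_left 1)"
    using tendsto_mult[OF tendsto_one_minus_powr[of "l + 1"]] by fastforce
qed

text \<open>
  An average is bounded by the average of a majorant; finitely many exceptions do not change it,
  because the weight of every single index tends to \<open>0\<close>.
\<close>
lemma abel_mean_norm_le:
  fixes v :: "nat \<Rightarrow> real"
  assumes l: "0 < l" and u: "abel_mean l u L" and v: "abel_mean l (\<lambda>N. of_real (v N)) M"
    and B: "0 \<le> B" and v0: "\<And>N. 0 \<le> v N" and le: "\<And>N. N \<ge> n \<Longrightarrow> norm (u N) \<le> B * v N"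
  shows "norm L \<le> B * Re M"
proof -
  define u' where "u' = (\<lambda>N. u N + (- 1) * (if N < n then u N else 0))"
  have u': "abel_mean l u' L"
    using abel_mean_add[OF u abel_mean_cmult[OF abel_mean_finite_support[OF l], of "- 1"]]
    unfolding u'_def by simp
  have le': "norm (u' N) \<le> B * v N" for N
    using le[of N] B v0[of N] by (auto simp: u'_def)
  let ?S = "\<lambda>u r. \<Sum>N. complex_of_real (cesaro_coeff l N * r ^ N) * u N"
  have 1: "((\<lambda>r. norm (of_real ((1 - r) powr (l + 1)) * ?S u' r)) \<longlongrightarrow> norm L) (at_left 1)"
    using u' unfolding abel_mean_def by (intro tendsto_norm) auto
  have 2: "((\<lambda>r. B * Re (of_real ((1 - r) powr (l + 1)) * ?S (\<lambda>N. of_real (v N)) r)) \<longlongrightarrow> B * Re M) (at_left 1)"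
    using v unfolding abel_mean_def by (intro tendsto_mult_left tendsto_Re) auto
  show ?thesis
  proof (rule tendsto_le[OF _ 2 1])
    show "\<forall>\<^sub>F r in at_left 1. norm (of_real ((1 - r) powr (l + 1)) * ?S u' r)
        \<le> B * Re (of_real ((1 - r) powr (l + 1)) * ?S (\<lambda>N. of_real (v N)) r)"
    proof (rule eventually_mono[OF eventually_at_left_1])
      fix r :: real assume r: "0 < r \<and> r < 1"
      have A: "0 \<le> cesaro_coeff l N * r ^ N" for N using cesaro_coeff_pos[OF l, of N] r by simp
      have sv: "summable (\<lambda>N. complex_of_real (cesaro_coeff l N * r ^ N) * of_real (v N))"
        using v r unfolding abel_mean_def by auto
      then have sv': "summable (\<lambda>N. cesaro_coeff l N * r ^ N * v N)"
        unfolding of_real_mult[symmetric] summable_of_real_iff .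
      have "norm (?S u' r) \<le> (\<Sum>N. B * (cesaro_coeff l N * r ^ N * v N))"
      proof (rule norm_suminf_le[OF _ summable_mult[OF sv']])
        fix N
        show "norm (complex_of_real (cesaro_coeff l N * r ^ N) * u' N) \<le> B * (cesaro_coeff l N * r ^ N * v N)"
          using mult_left_mono[OF le'[of N] A[of N]] A[of N]
          unfolding norm_mult norm_of_real by (simp only: mult_ac abs_of_nonneg)
      qed
      also have "\<dots> = B * (\<Sum>N. cesaro_coeff l N * r ^ N * v N)" by (rule suminf_mult[OF sv'])
      also have "(\<Sum>N. cesaro_coeff l N * r ^ N * v N) = Re (?S (\<lambda>N. of_real (v N)) r)"
        unfolding of_real_mult[symmetric] suminf_of_real[OF sv', symmetric] by simp
      finally have "norm (?S u' r) \<le> B * Re (?S (\<lambda>N. of_real (v N)) r)" .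
      from mult_left_mono[OF this, of "(1 - r) powr (l + 1)"]
      show "norm (of_real ((1 - r) powr (l + 1)) * ?S u' r)
        \<le> B * Re (of_real ((1 - r) powr (l + 1)) * ?S (\<lambda>N. of_real (v N)) r)"
        by (simp add: norm_mult mult_ac)
    qed
  qed (rule trivial_limit_at_left_real)
qed

lemma prod_eq_single:
  assumes "finite J" "i \<in> J" "\<And>j. j \<in> J \<Longrightarrow> j \<noteq> i \<Longrightarrow> G j = 1"
  shows "(\<Prod>j\<in>J. G j) = (G i :: complex)"
  using prod.remove[OF assms(1,2), of G] prod.neutral[of "J - {i}" G] assms(3) by auto

definition mult_indep :: "nat set \<Rightarrow> (nat \<Rightarrow> complex) \<Rightarrow> bool" where
  "mult_indep J w \<longleftrightarrow> (\<forall>a :: nat \<Rightarrow> int. (\<Prod>j\<in>J. w j powi a j) = 1 \<longrightarrow> (\<forall>j\<in>J. a j = 0))"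

lemma mult_indepD:
  "mult_indep J w \<Longrightarrow> (\<Prod>j\<in>J. w j powi a j) = 1 \<Longrightarrow> j \<in> J \<Longrightarrow> a j = 0"
  unfolding mult_indep_def by blast

lemma mult_indep_inj:
  assumes "mult_indep J w" "\<And>j. j \<in> J \<Longrightarrow> w j \<noteq> 0"
    and "(\<Prod>j\<in>J. w j powi a j) = (\<Prod>j\<in>J. w j powi b j)" "j \<in> J"
  shows "a j = b j"
proof -
  have "(\<Prod>j\<in>J. w j powi (a j - b j)) = (\<Prod>j\<in>J. w j powi a j) / (\<Prod>j\<in>J. w j powi b j)"
    unfolding prod_dividef[symmetric] using assms(2) by (intro prod.cong) (auto simp: power_int_diff)
  also have "\<dots> = 1"
  proof -
    have "(\<Prod>j\<in>J. w j powi b j) \<noteq> 0"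
      using assms(2) by (cases "finite J") auto
    then show ?thesis using assms(3) by simp
  qed
  finally have "a j - b j = 0"
    using assms(1,4) unfolding mult_indep_def by (auto dest!: spec[of _ "\<lambda>j. a j - b j"])
  then show ?thesis by simp
qed

text \<open>
  The coefficient of \<open>w\<^sup>e\<close>, \<open>e \<in> {- 1, 0, 1}\<close>, in \<open>1 + Re (c w)\<close> for \<open>|w| = 1\<close>.
\<close>
definition riesz_coeff :: "complex \<Rightarrow> int \<Rightarrow> complex" where
  "riesz_coeff c e = (if e = 0 then 1 else if e = 1 then c / 2 else cnj c / 2)"

definition riesz_product :: "nat set \<Rightarrow> (nat \<Rightarrow> complex) \<Rightarrow> (nat \<Rightarrow> complex) \<Rightarrow> nat \<Rightarrow> real" where
  "riesz_product J c w N = (\<Prod>j\<in>J. 1 + Re (c j * w j ^ N))"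

lemma riesz_product_nonneg:
  assumes "\<And>j. j \<in> J \<Longrightarrow> norm (c j) = 1" "\<And>j. j \<in> J \<Longrightarrow> norm (w j) = 1"
  shows "0 \<le> riesz_product J c w N"
  unfolding riesz_product_def
proof (rule prod_nonneg)
  fix j assume "j \<in> J"
  then have "norm (c j * w j ^ N) = 1" using assms by (simp add: norm_mult norm_power)
  then show "0 \<le> 1 + Re (c j * w j ^ N)" using abs_Re_le_cmod[of "c j * w j ^ N"] by linarith
qed

lemma riesz_product_expand:
  assumes J: "finite J" and w: "\<And>j. j \<in> J \<Longrightarrow> norm (w j) = 1"
  shows "complex_of_real (riesz_product J c w N) =
     (\<Sum>g\<in>PiE J (\<lambda>_. {-1, 0, 1}). (\<Prod>j\<in>J. riesz_coeff (c j) (g j)) * (\<Prod>j\<in>J. w j powi g j) ^ N)"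
proof -
  have factor: "complex_of_real (1 + Re (c j * w j ^ N)) =
      (\<Sum>e\<in>{-1, 0, 1}. riesz_coeff (c j) e * (w j powi e) ^ N)" if "j \<in> J" for j
  proof -
    have "w j * cnj (w j) = 1" using w[OF that] complex_norm_square[of "w j"] by simp
    then have "inverse (w j) = cnj (w j)" by (rule inverse_unique)
    moreover have "complex_of_real (Re z) = (z + cnj z) / 2" for z
      by (simp add: complex_add_cnj)
    ultimately show ?thesis
      by (simp add: riesz_coeff_def add_divide_distrib del: times_complex.sel)
  qed
  have "complex_of_real (riesz_product J c w N) =
      (\<Prod>j\<in>J. \<Sum>e\<in>{-1, 0, 1}. riesz_coeff (c j) e * (w j powi e) ^ N)"
    unfolding riesz_product_def of_real_prod using factor by (intro prod.cong) auto
  also have "\<dots> = (\<Sum>g\<in>PiE J (\<lambda>_. {-1, 0, 1}). \<Prod>j\<in>J. riesz_coeff (c j) (g j) * (w j powi g j) ^ N)"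
    by (rule prod_sum_PiE) (use J in auto)
  finally show ?thesis by (simp add: prod.distrib prod_power_distrib)
qed

text \<open>
  If \<open>uh \<zeta>\<close> is the Fourier--Bohr coefficient of \<open>u\<close> at the frequency \<open>\<zeta>\<close>, then the average of \<open>u\<close>
  against a Riesz product is the corresponding combination of the coefficients at the frequencies
  that occur in the product.
\<close>
lemma abel_mean_riesz:
  assumes J: "finite J" and w: "\<And>j. j \<in> J \<Longrightarrow> norm (w j) = 1"
    and u: "\<And>\<zeta>. norm \<zeta> = 1 \<Longrightarrow> abel_mean l (\<lambda>N. u N * \<zeta> ^ N) (uh \<zeta>)"
  shows "abel_mean l (\<lambda>N. u N * of_real (riesz_product J c w N))
     (\<Sum>g\<in>PiE J (\<lambda>_. {-1, 0, 1}). (\<Prod>j\<in>J. riesz_coeff (c j) (g j)) * uh (\<Prod>j\<in>J. w j powi g j))"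
proof -
  have "norm (\<Prod>j\<in>J. w j powi g j) = 1" for g
    using w by (simp add: prod_norm[symmetric] norm_power_int)
  then have "abel_mean l (\<lambda>N. \<Sum>g\<in>PiE J (\<lambda>_. {-1, 0, 1}). (\<Prod>j\<in>J. riesz_coeff (c j) (g j)) *
         (u N * (\<Prod>j\<in>J. w j powi g j) ^ N))
     (\<Sum>g\<in>PiE J (\<lambda>_. {-1, 0, 1}). (\<Prod>j\<in>J. riesz_coeff (c j) (g j)) * uh (\<Prod>j\<in>J. w j powi g j))"
    by (intro abel_mean_sum abel_mean_cmult u) 
  moreover have "complex_of_real (riesz_product J c w N) =
     (\<Sum>g\<in>PiE J (\<lambda>_. {-1, 0, 1}). (\<Prod>j\<in>J. riesz_coeff (c j) (g j)) * (\<Prod>j\<in>J. w j powi g j) ^ N)"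
    for N using J w by (rule riesz_product_expand)
  ultimately show ?thesis
    by (simp only: sum_distrib_left mult_ac)
qed

text \<open>
  The constant sequence has the only frequency \<open>1\<close>, and by independence only the constant term of
  the Riesz product has this frequency. So the Riesz product is a probability density.
\<close>
lemma abel_mean_riesz_one:
  assumes l: "0 < l" and J: "finite J" and w: "\<And>j. j \<in> J \<Longrightarrow> norm (w j) = 1"
    and indep: "mult_indep J w"
  shows "abel_mean l (\<lambda>N. of_real (riesz_product J c w N)) 1"
proof -
  let ?uh = "\<lambda>\<zeta>::complex. if \<zeta> = 1 then 1 else 0 :: complex"
  have u: "abel_mean l (\<lambda>N. 1 * \<zeta> ^ N) (?uh \<zeta>)" if "norm \<zeta> = 1" for \<zeta>
    using abel_mean_one[of l] abel_mean_power[OF l that] by auto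
  define z where "z = (\<lambda>j\<in>J. 0 :: int)"
  have "(\<Sum>g\<in>PiE J (\<lambda>_. {-1, 0, 1}). (\<Prod>j\<in>J. riesz_coeff (c j) (g j)) * ?uh (\<Prod>j\<in>J. w j powi g j))
      = (\<Sum>g\<in>{z}. (\<Prod>j\<in>J. riesz_coeff (c j) (g j)) * ?uh (\<Prod>j\<in>J. w j powi g j))"
  proof (rule sum.mono_neutral_right)
    show "\<forall>g\<in>PiE J (\<lambda>_. {-1, 0, 1}) - {z}.
        (\<Prod>j\<in>J. riesz_coeff (c j) (g j)) * ?uh (\<Prod>j\<in>J. w j powi g j) = 0"
    proof
      fix g assume g: "g \<in> PiE J (\<lambda>_. {-1, 0, 1 :: int}) - {z}"
      have "(\<Prod>j\<in>J. w j powi g j) \<noteq> 1"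
      proof
        assume "(\<Prod>j\<in>J. w j powi g j) = 1"
        then have "\<forall>j\<in>J. g j = 0" using indep unfolding mult_indep_def by auto
        then have "g = z" using g by (auto simp: z_def PiE_def extensional_def)
        then show False using g by auto
      qed
      then show "(\<Prod>j\<in>J. riesz_coeff (c j) (g j)) * ?uh (\<Prod>j\<in>J. w j powi g j) = 0" by simp
    qed
  qed (use J in \<open>auto simp: z_def intro: finite_PiE\<close>)
  also have "\<dots> = 1" by (simp add: z_def riesz_coeff_def)
  finally show ?thesis using abel_mean_riesz[where w = w and c = c, OF J w u] by simp
qed

text \<open>
  By independence, among the frequencies in the Riesz product only the terms \<open>w i\<close> and \<open>cnj (w i)\<close>
  meet the spectrum of the kernel at \<open>w i\<close>. All other terms average to
  \<open>0\<close>, and the unimodular coefficient \<open>c i\<close> rotates the two contributions to a positive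
  number.
\<close>
lemma abel_mean_riesz_kernel:
  assumes l: "0 < l" and J: "finite J" and w: "\<And>j. j \<in> J \<Longrightarrow> norm (w j) = 1"
    and indep: "mult_indep J w" and i: "i \<in> J"
    and \<gamma>1: "abel_mean l (\<lambda>N. of_real (cesaro_kernel l N (Re (w i))) * cnj (w i) ^ N) \<gamma>"
    and \<gamma>2: "abel_mean l (\<lambda>N. of_real (cesaro_kernel l N (Re (w i))) * w i ^ N) (cnj \<gamma>)"
    and c: "c i * cnj \<gamma> = of_real (norm \<gamma>)"
  shows "abel_mean l (\<lambda>N. of_real (cesaro_kernel l N (Re (w i))) * of_real (riesz_product J c w N))
           (of_real (norm \<gamma>))"
proof -
  have w0: "w j \<noteq> 0" if "j \<in> J" for j using w[OF that] by auto
  have "w i * cnj (w i) = 1" using w[OF i] complex_norm_square[of "w i"] by simp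
  then have inv: "inverse (w i) = cnj (w i)" by (rule inverse_unique)
  let ?uh = "\<lambda>\<zeta>. if \<zeta> = w i then cnj \<gamma> else if \<zeta> = cnj (w i) then \<gamma> else 0"
  have u: "abel_mean l (\<lambda>N. of_real (cesaro_kernel l N (Re (w i))) * \<zeta> ^ N) (?uh \<zeta>)"
    if "norm \<zeta> = 1" for \<zeta>
    using \<gamma>1 \<gamma>2 abel_mean_kernel_off_spectrum[OF l w[OF i] refl that] by auto
  \<comment> \<open>The exponents that single out \<open>w i\<close> and \<open>cnj (w i)\<close>.\<close>
  define p where "p = (\<lambda>j\<in>J. if j = i then 1 else 0 :: int)"
  define q where "q = (\<lambda>j\<in>J. if j = i then - 1 else 0 :: int)"
  have prod1: "(\<Prod>j\<in>J. F j (p j)) = F i 1" "(\<Prod>j\<in>J. F j (q j)) = F i (- 1)"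
    if "\<And>j. j \<in> J \<Longrightarrow> F j 0 = (1 :: complex)" for F :: "nat \<Rightarrow> int \<Rightarrow> complex"
    using prod_eq_single[OF J i, of "\<lambda>j. F j (p j)"] prod_eq_single[OF J i, of "\<lambda>j. F j (q j)"] that i
    by (simp_all add: p_def q_def)
  have wp: "(\<Prod>j\<in>J. w j powi p j) = w i" "(\<Prod>j\<in>J. w j powi q j) = cnj (w i)"
    using inv by (subst prod1; simp)+
  have cp: "(\<Prod>j\<in>J. riesz_coeff (c j) (p j)) = c i / 2" "(\<Prod>j\<in>J. riesz_coeff (c j) (q j)) = cnj (c i) / 2"
    by (subst prod1; simp add: riesz_coeff_def)+
  have pq: "p \<noteq> q"
  proof
    assume "p = q"
    from fun_cong[OF this, of i] i show False by (simp add: p_def q_def)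
  qed
  have wi: "w i \<noteq> cnj (w i)"
  proof
    assume "w i = cnj (w i)"
    then have "(\<Prod>j\<in>J. w j powi p j) = (\<Prod>j\<in>J. w j powi q j)" using wp by simp
    from mult_indep_inj[OF indep w0 this i] show False using i by (simp add: p_def q_def)
  qed
  have "(\<Sum>g\<in>PiE J (\<lambda>_. {-1, 0, 1}). (\<Prod>j\<in>J. riesz_coeff (c j) (g j)) * ?uh (\<Prod>j\<in>J. w j powi g j))
      = (\<Sum>g\<in>{p, q}. (\<Prod>j\<in>J. riesz_coeff (c j) (g j)) * ?uh (\<Prod>j\<in>J. w j powi g j))"
  proof (rule sum.mono_neutral_right)
    show "\<forall>g\<in>PiE J (\<lambda>_. {-1, 0, 1}) - {p, q}.
        (\<Prod>j\<in>J. riesz_coeff (c j) (g j)) * ?uh (\<Prod>j\<in>J. w j powi g j) = 0"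
    proof
      fix g assume g: "g \<in> PiE J (\<lambda>_. {-1, 0, 1 :: int}) - {p, q}"
      have "g = h" if "(\<Prod>j\<in>J. w j powi g j) = (\<Prod>j\<in>J. w j powi h j)" "h \<in> {p, q}" for h
      proof
        fix j show "g j = h j"
        proof (cases "j \<in> J")
          case True
          show ?thesis by (rule mult_indep_inj[OF indep w0 that(1) True])
        next
          case False
          then show ?thesis using g that(2) by (auto simp: p_def q_def PiE_def extensional_def)
        qed
      qed
      then have "(\<Prod>j\<in>J. w j powi g j) \<noteq> w i" "(\<Prod>j\<in>J. w j powi g j) \<noteq> cnj (w i)"
        using g wp by (metis DiffD2 insertCI)+
      then show "(\<Prod>j\<in>J. riesz_coeff (c j) (g j)) * ?uh (\<Prod>j\<in>J. w j powi g j) = 0" by simp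
    qed
    show "{p, q} \<subseteq> PiE J (\<lambda>_. {-1, 0, 1})" by (auto simp: p_def q_def)
  qed (use J in \<open>auto intro: finite_PiE\<close>)
  also have "\<dots> = (c i * cnj \<gamma> + cnj (c i * cnj \<gamma>)) / 2"
    using pq wi by (simp add: wp cp add_divide_distrib)
  also have "\<dots> = of_real (norm \<gamma>)" unfolding c by simp
  finally show ?thesis using abel_mean_riesz[where w = w and c = c, OF J w u] by simp
qed

text \<open>
  A Riesz product with suitable phases is a density against which every kernel in the sum averages
  to the modulus of its amplitude at once. If the sum were eventually bounded by \<open>B\<close>, then so would be
  its average. The density favours the indices at which the phases are nearly aligned,
  which exist by Kronecker's theorem.
\<close>
theorem kernel_combination_large:
  assumes l: "0 < l" and J: "finite J" and w: "\<And>j. j \<in> J \<Longrightarrow> norm (w j) = 1"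
    and indep: "mult_indep J w" and wt: "\<And>j. j \<in> J \<Longrightarrow> 0 \<le> wt j"
    and B: "B < (\<Sum>j\<in>J. wt j * (2 powr (- l) * norm (1 - w j) powr (- (2 * l + 1))))"
  shows "\<exists>N\<ge>n. B < \<bar>\<Sum>j\<in>J. wt j * cesaro_kernel l N (Re (w j))\<bar>"
proof (rule ccontr)
  assume "\<not> ?thesis"
  then have le: "\<bar>\<Sum>j\<in>J. wt j * cesaro_kernel l N (Re (w j))\<bar> \<le> B" if "N \<ge> n" for N
    using that by (auto simp: not_less)
  have w2: "(w j)\<^sup>2 \<noteq> 1" if "j \<in> J" for j
  proof
    assume a: "(w j)\<^sup>2 = 1"
    have "(\<Prod>k\<in>J. w k powi (if k = j then 2 else 0)) = w j powi 2"
      using prod_eq_single[OF J that, of "\<lambda>k. w k powi (if k = j then 2 else 0)"] by simp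
    also have "\<dots> = 1" using a by simp
    finally show False using indep that unfolding mult_indep_def
      by (auto dest!: spec[of _ "\<lambda>k. if k = j then 2 else 0"])
  qed
  have "\<forall>j\<in>J. \<exists>\<gamma>. abel_mean l (\<lambda>N. of_real (cesaro_kernel l N (Re (w j))) * cnj (w j) ^ N) \<gamma> \<and>
             abel_mean l (\<lambda>N. of_real (cesaro_kernel l N (Re (w j))) * w j ^ N) (cnj \<gamma>) \<and>
             2 powr (- l) * norm (1 - w j) powr (- (2 * l + 1)) \<le> norm \<gamma>"
    using abel_mean_kernel_on_spectrum[OF l w refl w2] by blast
  then obtain \<gamma> where \<gamma>: "\<And>j. j \<in> J \<Longrightarrow>
        abel_mean l (\<lambda>N. of_real (cesaro_kernel l N (Re (w j))) * cnj (w j) ^ N) (\<gamma> j)"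
      "\<And>j. j \<in> J \<Longrightarrow> abel_mean l (\<lambda>N. of_real (cesaro_kernel l N (Re (w j))) * w j ^ N) (cnj (\<gamma> j))"
      "\<And>j. j \<in> J \<Longrightarrow> 2 powr (- l) * norm (1 - w j) powr (- (2 * l + 1)) \<le> norm (\<gamma> j)"
    unfolding bchoice_iff by blast
  \<comment> \<open>Unimodular phases with \<open>c j * cnj (\<gamma> j) = |\<gamma> j|\<close>.\<close>
  define c where "c = (\<lambda>j. if \<gamma> j = 0 then 1 else \<gamma> j / of_real (norm (\<gamma> j)))"
  have c1: "norm (c j) = 1" for j by (simp add: c_def norm_divide)
  have c2: "c j * cnj (\<gamma> j) = of_real (norm (\<gamma> j))" for j
    using complex_norm_square[of "\<gamma> j"] by (auto simp: c_def power2_eq_square field_simps)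
  define S where "S = (\<Sum>j\<in>J. wt j * norm (\<gamma> j))"
  let ?a = "\<lambda>N. \<Sum>j\<in>J. wt j * cesaro_kernel l N (Re (w j))"
  have "abel_mean l (\<lambda>N. \<Sum>j\<in>J. of_real (wt j) * (of_real (cesaro_kernel l N (Re (w j))) *
            of_real (riesz_product J c w N))) (\<Sum>j\<in>J. of_real (wt j) * of_real (norm (\<gamma> j)))"
    by (intro abel_mean_sum abel_mean_cmult abel_mean_riesz_kernel[where \<gamma> = "\<gamma> _"] l J w indep \<gamma> c2)
  then have "abel_mean l (\<lambda>N. of_real (?a N * riesz_product J c w N)) (of_real S)"
    by (simp add: S_def sum_distrib_right mult.assoc)
  moreover have "0 \<le> B" using le[of n] by simp
  moreover have "norm (complex_of_real (?a N * riesz_product J c w N)) \<le> B * riesz_product J c w N"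
    if "N \<ge> n" for N
    using le[OF that] riesz_product_nonneg[of J c w N, OF c1 w]
    unfolding norm_of_real abs_mult by (intro mult_mono) auto
  ultimately have "norm (complex_of_real S) \<le> B * Re 1"
    by (intro abel_mean_norm_le[OF l _ abel_mean_riesz_one[where w = w and c = c, OF l J w indep]])
       (auto intro: riesz_product_nonneg c1 w)
  moreover have "(\<Sum>j\<in>J. wt j * (2 powr (- l) * norm (1 - w j) powr (- (2 * l + 1)))) \<le> S"
    unfolding S_def by (intro sum_mono mult_left_mono \<gamma>(3) wt)
  ultimately show False using B by simp
qed

section \<open>Null sets and caps on the sphere\<close>

lemma measurable_sphere_to_borel: "(\<lambda>x. x) \<in> sphere_measure \<rightarrow>\<^sub>M borel"
  unfolding measurable_cong_sets[OF sets_sphere_measure refl]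
  by (rule measurable_restrict_space1) simp

lemma sets_sphere_measureI:
  "B \<in> sets borel \<Longrightarrow> B \<subseteq> sphere 0 1 \<Longrightarrow> B \<in> sets (sphere_measure :: 'a::euclidean_space measure)"
  unfolding sets_sphere_measure sets_restrict_space by auto

lemma emeasure_sphere_measure:
  fixes B :: "'a::euclidean_space set"
  assumes B: "B \<in> sets borel" "B \<subseteq> sphere 0 1"
  shows "emeasure sphere_measure B =
           emeasure lborel (ball 0 1 \<inter> sgn -` B) / emeasure lborel (ball (0::'a) 1)"
proof -
  let ?U = "uniform_measure lborel (ball (0::'a) 1)"
  have m: "sgn \<in> measurable ?U (borel :: 'a measure)" by measurable
  have s: "sgn -` B \<in> sets lborel"
    using measurable_sets[OF m B(1)] by simp
  have "emeasure sphere_measure B = emeasure (distr ?U borel sgn) B"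
    unfolding sphere_measure_def using B by (subst emeasure_restrict_space) auto
  also have "\<dots> = emeasure ?U (sgn -` B)"
    using emeasure_distr[OF m B(1)] by simp
  also have "\<dots> = emeasure lborel (ball 0 1 \<inter> sgn -` B) / emeasure lborel (ball (0::'a) 1)"
    using s by (intro emeasure_uniform_measure) auto
  finally show ?thesis .
qed

lemma measure_sphere_measure:
  fixes B :: "'a::euclidean_space set"
  assumes B: "B \<in> sets borel" "B \<subseteq> sphere 0 1"
  shows "measure sphere_measure B =
           measure lborel (ball 0 1 \<inter> sgn -` B) / measure lborel (ball (0::'a) 1)"
proof -
  have p: "0 < measure lborel (ball (0::'a) 1)" using content_ball_pos[of 1 "0::'a"] by simp
  have f: "emeasure lborel (ball (0::'a) 1) \<noteq> \<infinity>" using emeasure_lborel_ball_finite[of "0::'a" 1] by auto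
  have f': "emeasure lborel (ball (0::'a) 1 \<inter> sgn -` B) \<noteq> \<infinity>"
  proof -
    have "emeasure lborel (ball (0::'a) 1 \<inter> sgn -` B) \<le> emeasure lborel (ball (0::'a) 1)"
      by (rule emeasure_mono) auto
    then show ?thesis using f by (auto simp: top_unique)
  qed
  show ?thesis
    unfolding measure_def emeasure_sphere_measure[OF B]
    using p f f' 
    by (simp add: emeasure_eq_ennreal_measure divide_ennreal measure_nonneg)
qed

text \<open>
  The cone lies in the frontier of the convex cone \<open>{z. c * norm z \<le> x \<bullet> z}\<close>: a small step orthogonal to
  \<open>x\<close> that does not decrease the norm leads out of the latter.
\<close>
lemma negligible_cone_pos:
  fixes x :: "'a::euclidean_space"
  assumes dim: "2 \<le> DIM('a)" and c: "0 < c"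
  shows "negligible {z. x \<bullet> z = c * norm z}"
proof -
  let ?S = "{z. c * norm z \<le> x \<bullet> z}"
  have "convex ?S"
  proof (rule convexI)
    fix y z :: 'a and u v :: real
    assume "y \<in> ?S" "z \<in> ?S" "0 \<le> u" "0 \<le> v" "u + v = 1"
    then have "c * norm y * u + c * norm z * v \<le> (x \<bullet> y) * u + (x \<bullet> z) * v"
      by (intro add_mono mult_right_mono) auto
    moreover have "norm (u *\<^sub>R y + v *\<^sub>R z) \<le> u * norm y + v * norm z"
      using norm_triangle_ineq[of "u *\<^sub>R y" "v *\<^sub>R z"] \<open>0 \<le> u\<close> \<open>0 \<le> v\<close> by simp
    from mult_left_mono[OF this, of c] c
    have "c * norm (u *\<^sub>R y + v *\<^sub>R z) \<le> c * norm y * u + c * norm z * v"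
      by (simp add: algebra_simps)
    ultimately show "u *\<^sub>R y + v *\<^sub>R z \<in> ?S"
      by (simp add: inner_add_right inner_scaleR_right algebra_simps)
  qed
  then have "negligible (frontier ?S)" by (rule negligible_convex_frontier)
  moreover have "{z. x \<bullet> z = c * norm z} \<subseteq> frontier ?S"
  proof
    fix z assume "z \<in> {z. x \<bullet> z = c * norm z}"
    then have z: "x \<bullet> z = c * norm z" by simp
    obtain v0 where v0: "v0 \<noteq> 0" "orthogonal x v0"
      using orthogonal_to_vector_exists[OF dim, of x] by auto
    \<comment> \<open>Of the two opposite directions, the one in which the norm does not decrease.\<close>
    define v where "v = (if z \<bullet> v0 \<ge> 0 then v0 else - v0)"
    have v: "v \<noteq> 0" "x \<bullet> v = 0" "z \<bullet> v \<ge> 0"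
      using v0 by (auto simp: v_def orthogonal_def inner_minus_right)
    have out: "z + e *\<^sub>R v \<notin> ?S" if "0 < e" for e
    proof -
      have "(norm (z + e *\<^sub>R v))\<^sup>2 = (norm z)\<^sup>2 + 2 * e * (z \<bullet> v) + e\<^sup>2 * (norm v)\<^sup>2"
        unfolding power2_norm_eq_inner inner_add_left inner_add_right inner_scaleR_left inner_scaleR_right
          inner_commute[of v z] by (simp add: power2_eq_square distrib_left)
      moreover have "0 < e\<^sup>2 * (norm v)\<^sup>2" "0 \<le> 2 * e * (z \<bullet> v)" using v that by auto
      ultimately have "(norm z)\<^sup>2 < (norm (z + e *\<^sub>R v))\<^sup>2" by linarith
      then have "norm z < norm (z + e *\<^sub>R v)" by (rule power2_less_imp_less) simp
      then have "c * norm z < c * norm (z + e *\<^sub>R v)" using c by simp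
      then show ?thesis using z v by (simp add: inner_add_right)
    qed
    have "z \<notin> interior ?S"
    proof
      assume "z \<in> interior ?S"
      then obtain e where e: "0 < e" "ball z e \<subseteq> ?S" by (auto simp: mem_interior)
      have "z + (e / (2 * norm v)) *\<^sub>R v \<in> ball z e"
        using v e by (simp add: dist_norm)
      moreover have "0 < e / (2 * norm v)" using e v by simp
      ultimately show False using out e by blast
    qed
    moreover have "z \<in> closure ?S" using z closure_subset[of ?S] by auto
    ultimately show "z \<in> frontier ?S" by (simp add: frontier_def)
  qed
  ultimately show ?thesis by (rule negligible_subset)
qed

lemma negligible_cone:
  fixes x :: "'a::euclidean_space"
  assumes dim: "2 \<le> DIM('a)" and x: "x \<noteq> 0"
  shows "negligible {z. x \<bullet> z = c * norm z}"
proof (cases c "0::real" rule: linorder_cases)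
  case greater
  then show ?thesis by (rule negligible_cone_pos[OF dim])
next
  case equal
  then show ?thesis using negligible_hyperplane[of x 0] x by simp
next
  case less
  have "{z. x \<bullet> z = c * norm z} = {z. (- x) \<bullet> z = (- c) * norm z}" by auto
  then show ?thesis using negligible_cone_pos[OF dim, of "- c" "- x"] less by simp
qed

lemma AE_sphere_inner_neq:
  fixes x :: "'a::euclidean_space"
  assumes dim: "2 \<le> DIM('a)" and x: "x \<noteq> 0"
  shows "AE y in sphere_measure. x \<bullet> y \<noteq> c"
proof (rule AE_I)
  let ?B = "{y \<in> sphere 0 1. x \<bullet> y = c}"
  show "{y \<in> space sphere_measure. \<not> x \<bullet> y \<noteq> c} \<subseteq> ?B" by auto
  have "closed ?B"
    unfolding Collect_conj_eq Collect_mem_eq by (intro closed_Int closed_hyperplane) auto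
  then have B: "?B \<in> sets borel" by simp
  then show "?B \<in> sets sphere_measure" by (rule sets_sphere_measureI) auto
  have "emeasure lborel (ball 0 1 \<inter> sgn -` ?B) = 0"
  proof (rule emeasure_eq_0)
    have "negligible {z. x \<bullet> z = c * norm z}" by (rule negligible_cone[OF dim x])
    moreover have cl: "closed {z. x \<bullet> z = c * norm z}"
      by (intro closed_Collect_eq continuous_intros)
    ultimately show "emeasure lborel {z. x \<bullet> z = c * norm z} = 0"
      by (simp add: negligible_iff_null_sets null_sets_def)
    show "{z. x \<bullet> z = c * norm z} \<in> sets lborel" using cl by simp
    show "ball 0 1 \<inter> sgn -` ?B \<subseteq> {z. x \<bullet> z = c * norm z}"
    proof
      fix z assume z: "z \<in> ball 0 1 \<inter> sgn -` ?B"
      then have "norm z \<noteq> 0" "x \<bullet> sgn z = c" by (auto simp: sgn_zero)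
      then show "z \<in> {z. x \<bullet> z = c * norm z}" by (simp add: sgn_div_norm field_simps)
    qed
  qed
  then show "emeasure sphere_measure ?B = 0"
    by (subst emeasure_sphere_measure[OF B]) auto
qed

definition cap :: "'a::euclidean_space \<Rightarrow> real \<Rightarrow> 'a set" where
  "cap x r = {y \<in> sphere 0 1. dist x y < r}"

lemma cap_borel: "cap x r \<in> sets borel"
proof -
  have "cap x r = sphere 0 1 \<inter> ball x r" by (auto simp: cap_def)
  then show ?thesis by simp
qed

lemma sets_cap [measurable]: "cap x r \<in> sets sphere_measure"
  by (rule sets_sphere_measureI[OF cap_borel]) (auto simp: cap_def)

lemma dist_sgn_le:
  assumes x: "norm x = 1" and s: "0 < s"
  shows "dist x (sgn z) \<le> 2 * dist z (s *\<^sub>R x) / s"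
proof (cases "z = 0")
  case True
  then show ?thesis using x s by (simp add: sgn_zero)
next
  case False
  have 1: "norm (z - s *\<^sub>R x) \<ge> \<bar>norm z - s\<bar>"
    using norm_triangle_ineq3[of z "s *\<^sub>R x"] x s by simp
  have "s *\<^sub>R (sgn z - x) = (s - norm z) *\<^sub>R sgn z + (z - s *\<^sub>R x)"
    using False by (simp add: sgn_div_norm algebra_simps)
  then have "s * norm (sgn z - x) = norm ((s - norm z) *\<^sub>R sgn z + (z - s *\<^sub>R x))"
    using s by (metis abs_of_pos norm_scaleR)
  also have "\<dots> \<le> \<bar>s - norm z\<bar> * norm (sgn z) + norm (z - s *\<^sub>R x)"
    using norm_triangle_ineq[of "(s - norm z) *\<^sub>R sgn z" "z - s *\<^sub>R x"] by simp
  also have "\<dots> \<le> 2 * norm (z - s *\<^sub>R x)" using 1 False by (simp add: norm_sgn)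
  finally show ?thesis using s by (simp add: dist_norm norm_minus_commute field_simps)
qed

text \<open>
  Projection to the sphere maps the segment from \<open>x / 4\<close> to \<open>3 x / 4\<close> to the point \<open>x\<close> and the
  \<open>r / 8\<close>-neighbourhood of this segment into the cap. In the neighbourhood there are about \<open>1 / r\<close> disjoint
  balls of radius \<open>r / 8\<close>, so that its volume is of order \<open>r\<^sup>n\<close> and not only \<open>r\<^sup>n\<^sup>+\<^sup>1\<close>.
\<close>
lemma measure_cap_ge:
  fixes x :: "'a::euclidean_space"
  assumes dim: "DIM('a) = n + 1" and x: "norm x = 1" and r: "0 < r" "r \<le> 1"
  shows "r ^ n / 8 ^ (n + 1) \<le> measure sphere_measure (cap x r)"
proof -
  \<comment> \<open>The centres \<open>s i *\<^sub>R x\<close> are \<open>r / 4\<close> apart and stay between \<open>x / 4\<close> and \<open>3 x / 4\<close>.\<close>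
  define m where "m = nat \<lfloor>2 / r\<rfloor>"
  define s where "s i = 1 / 4 + real i * r / 4" for i
  let ?V = "measure lborel (ball (0::'a) 1)"
  have V: "0 < ?V" using content_ball_pos[of 1 "0::'a"] by simp
  have r2: "2 / r \<ge> 2" using r by (simp add: field_simps)
  have m: "1 / r \<le> real m" "real m \<le> 2 / r"
  proof -
    have "real m = of_int \<lfloor>2 / r\<rfloor>" unfolding m_def using r by (intro of_nat_nat) simp
    moreover have "2 / r - 1 < of_int \<lfloor>2 / r\<rfloor>" by linarith
    moreover have "2 / r = 1 / r + 1 / r" "1 \<le> 1 / r" using r by (auto simp: field_simps)
    moreover have "of_int \<lfloor>2 / r\<rfloor> \<le> 2 / r" by linarith
    ultimately show "1 / r \<le> real m" "real m \<le> 2 / r" by linarith+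
  qed
  have s: "1 / 4 \<le> s i" "s i \<le> 3 / 4" if "i < m" for i
  proof -
    have "real i * r \<le> 2 / r * r" using that m(2) r by (intro mult_right_mono) auto
    then show "s i \<le> 3 / 4" using r by (simp add: s_def)
    show "1 / 4 \<le> s i" using r by (simp add: s_def)
  qed
  let ?B = "\<lambda>i. ball (s i *\<^sub>R x) (r / 8)"
  have sub: "?B i \<subseteq> ball 0 1 \<inter> sgn -` cap x r" if "i < m" for i
  proof
    fix z assume z: "z \<in> ?B i"
    have "norm z \<le> norm (s i *\<^sub>R x) + dist (s i *\<^sub>R x) z"
      using norm_triangle_ineq[of "s i *\<^sub>R x" "z - s i *\<^sub>R x"] by (simp add: dist_norm norm_minus_commute)
    also have "\<dots> < 1" using z s[OF that] x r by simp
    finally have z1: "norm z < 1" .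
    have z0: "z \<noteq> 0" using z s[OF that] x r by auto
    have "dist x (sgn z) \<le> 2 * dist z (s i *\<^sub>R x) / s i"
      by (rule dist_sgn_le[OF x]) (use s[OF that] in auto)
    also have "\<dots> < 2 * (r / 8) / s i"
      using z s[OF that] by (intro divide_strict_right_mono) (auto simp: dist_commute)
    also have "\<dots> \<le> 2 * (r / 8) / (1 / 4)"
      using s[OF that] r by (intro divide_left_mono) auto
    finally show "z \<in> ball 0 1 \<inter> sgn -` cap x r"
      using z0 z1 by (simp add: cap_def norm_sgn)
  qed
  have disj: "disjoint_family_on ?B {..<m}"
    unfolding disjoint_family_on_def
  proof (intro ballI impI)
    fix i j assume ij: "i \<in> {..<m}" "j \<in> {..<m}" "i \<noteq> j"
    have "1 \<le> \<bar>real i - real j\<bar>" using ij by linarith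
    then have "r / 4 \<le> \<bar>real i - real j\<bar> * (r / 4)" using r by simp
    also have "\<dots> = \<bar>s i - s j\<bar>"
    proof -
      have "s i - s j = (real i - real j) * (r / 4)" by (simp add: s_def algebra_simps)
      show ?thesis unfolding \<open>s i - s j = _\<close> abs_mult using r by simp
    qed
    also have "\<dots> = dist (s i *\<^sub>R x) (s j *\<^sub>R x)"
      using x by (simp add: dist_norm scaleR_diff_left[symmetric])
    finally show "?B i \<inter> ?B j = {}" by (intro disjoint_ballI) auto
  qed
  have Bm: "measure lborel (?B i) = (r / 8) ^ (n + 1) * ?V" for i
    using content_ball_conv_unit_ball[of "r / 8" "s i *\<^sub>R x"] r by (simp add: dim)
  have fb: "emeasure lborel (ball c r) \<noteq> \<infinity>" for c :: 'a and r
    using emeasure_lborel_ball_finite[of c r] by auto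
  have fin: "ball (0::'a) 1 \<inter> sgn -` cap x r \<in> fmeasurable lborel"
  proof (rule fmeasurableI2[of "ball 0 1"])
    have "sgn \<in> measurable lborel (borel :: 'a measure)" by measurable
    from measurable_sets[OF this cap_borel[of x r]]
    show "ball 0 1 \<inter> sgn -` cap x r \<in> sets lborel" by auto
  qed (auto intro!: fmeasurableI emeasure_lborel_ball_finite)
  have "r ^ n / 8 ^ (n + 1) * ?V = 1 / r * ((r / 8) ^ (n + 1) * ?V)"
    using r by (simp add: power_divide field_simps)
  also have "\<dots> \<le> real m * ((r / 8) ^ (n + 1) * ?V)"
    using m r V by (intro mult_right_mono) auto
  also have "\<dots> = (\<Sum>i\<in>{..<m}. measure lborel (?B i))" unfolding Bm by simp
  also have "\<dots> = measure lborel (\<Union>i\<in>{..<m}. ?B i)"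
    using disj fb by (intro measure_finite_Union[symmetric]) auto
  also have "\<dots> \<le> measure lborel (ball 0 1 \<inter> sgn -` cap x r)"
    using sub fin by (intro measure_mono_fmeasurable) auto
  finally have "r ^ n / 8 ^ (n + 1) * ?V \<le> measure lborel (ball 0 1 \<inter> sgn -` cap x r)" .
  then show ?thesis
    by (subst measure_sphere_measure[OF cap_borel]) (use V in \<open>auto simp: cap_def pos_le_divide_eq\<close>)
qed

section \<open>Points in general position\<close>

text \<open>
  The point of the upper half of the unit circle above \<open>t\<close>. For unit vectors \<open>x\<close> and \<open>y\<close>, the point
  above \<open>x \<bullet> y\<close> has the angle between \<open>x\<close> and \<open>y\<close> as its argument.
\<close>
definition upper_point :: "real \<Rightarrow> complex" where
  "upper_point t = Complex t (sqrt (1 - t\<^sup>2))"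

lemma Re_upper_point [simp]: "Re (upper_point t) = t"
  by (simp add: upper_point_def)

lemma norm_upper_point:
  assumes "\<bar>t\<bar> \<le> 1" shows "norm (upper_point t) = 1"
proof -
  have "t\<^sup>2 \<le> 1" using assms by (simp add: abs_square_le_1)
  then show ?thesis by (simp add: upper_point_def cmod_def)
qed

lemma measurable_upper_point: "upper_point \<in> borel_measurable borel"
proof -
  have "continuous_on UNIV upper_point"
    unfolding upper_point_def Complex_eq by (intro continuous_intros)
  then show ?thesis by (rule borel_measurable_continuous_onI)
qed

lemma inner_sphere_bound:
  assumes "norm x = 1" "norm y = 1" shows "\<bar>x \<bullet> y\<bar> \<le> 1"
  using Cauchy_Schwarz_ineq2[of x y] assms by simp

lemma norm_one_minus_upper_point:
  assumes "norm x = 1" "norm y = 1"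
  shows "norm (1 - upper_point (x \<bullet> y)) = dist x y"
proof -
  have t: "(x \<bullet> y)\<^sup>2 \<le> 1" using inner_sphere_bound[OF assms] by (simp add: abs_square_le_1)
  have "(norm (1 - upper_point (x \<bullet> y)))\<^sup>2 = 2 - 2 * (x \<bullet> y)"
    using t by (simp add: upper_point_def cmod_power2 power2_diff)
  also have "\<dots> = (dist x y)\<^sup>2"
  proof -
    have "x \<bullet> x = 1" "y \<bullet> y = 1" using assms by (simp_all add: dot_square_norm)
    then show ?thesis
      unfolding dist_norm power2_norm_eq_inner inner_diff_left inner_diff_right inner_commute[of y x]
      by simp
  qed
  finally show ?thesis by simp
qed

lemma measurable_power_int:
  fixes f :: "'b \<Rightarrow> complex"
  assumes "f \<in> borel_measurable M"
  shows "(\<lambda>x. f x powi k) \<in> borel_measurable M"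
  unfolding power_int_def using assms by (cases "0 \<le> k") auto

lemma AE_upper_point_power_neq:
  fixes x :: "'a::euclidean_space"
  assumes dim: "2 \<le> DIM('a)" and x: "norm x = 1" and k: "0 < k"
  shows "AE z in sphere_measure. upper_point (x \<bullet> z) ^ k \<noteq> C"
proof -
  have "AE z in sphere_measure. \<forall>\<zeta>\<in>{\<zeta>. \<zeta> ^ k = C}. x \<bullet> z \<noteq> Re \<zeta>"
    using k x by (intro AE_finite_allI finite_nth_roots AE_sphere_inner_neq[OF dim]) auto
  then show ?thesis
  proof eventually_elim
    case (elim z)
    then show ?case by (metis Re_upper_point mem_Collect_eq)
  qed
qed

text \<open>
  The condition on the next point \<open>\<zeta>\<close> that preserves independence. Lists of exponents are used because
  they form a countable type, which makes this a countable conjunction of measurable conditions.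
\<close>
definition fresh :: "nat \<Rightarrow> (nat \<Rightarrow> complex) \<Rightarrow> complex \<Rightarrow> bool" where
  "fresh m w \<zeta> \<longleftrightarrow> (\<forall>k>0. \<forall>as :: int list. \<zeta> ^ k \<noteq> (\<Prod>j<m. w j powi (as ! j)))"

lemma mult_indep_Suc:
  assumes "mult_indep {..<m} w" "fresh m w (w m)" "\<And>j. j < m \<Longrightarrow> w j \<noteq> 0" "w m \<noteq> 0"
  shows "mult_indep {..<Suc m} w"
  unfolding mult_indep_def
proof (intro allI impI)
  fix a :: "nat \<Rightarrow> int"
  assume "(\<Prod>j<Suc m. w j powi a j) = 1"
  then have eq: "(\<Prod>j<m. w j powi a j) * w m powi a m = 1" by simp
  have list: "(\<Prod>j<m. w j powi (map b [0..<m] ! j)) = (\<Prod>j<m. w j powi b j)" for b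
    by (intro prod.cong) auto
  have am: "a m = 0"
  proof (rule ccontr)
    assume "a m \<noteq> 0"
    then consider "a m > 0" | "a m < 0" by linarith
    then show False
    proof cases
      case 1
      have "w m ^ nat (a m) = w m powi a m" using 1 by (simp add: power_int_def)
      also have "\<dots> = inverse (\<Prod>j<m. w j powi a j)"
        using eq by (metis inverse_unique)
      also have "\<dots> = (\<Prod>j<m. w j powi (- a j))"
        by (simp add: prod_inversef[symmetric] power_int_minus)
      finally show False using assms(2) 1 list[of "\<lambda>j. - a j"] unfolding fresh_def
        by (metis zero_less_nat_eq)
    next
      case 2
      have "w m ^ nat (- a m) = inverse (w m powi a m)" using 2 by (simp add: power_int_def power_inverse)
      also have "\<dots> = (\<Prod>j<m. w j powi a j)"
        using eq by (metis inverse_unique mult.commute)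
      finally show False using assms(2) 2 list[of a] unfolding fresh_def
        by (metis neg_0_less_iff_less zero_less_nat_eq)
    qed
  qed
  then have "\<forall>j\<in>{..<m}. a j = 0" using eq assms(1) unfolding mult_indep_def by simp
  with am show "\<forall>j\<in>{..<Suc m}. a j = 0" by (auto simp: less_Suc_eq)
qed

lemma measurable_inner_sphere:
  "(\<lambda>p. fst p \<bullet> snd p) \<in> borel_measurable (sphere_measure \<Otimes>\<^sub>M (sphere_measure :: 'a::euclidean_space measure))"
proof -
  have "fst \<in> borel_measurable (sphere_measure \<Otimes>\<^sub>M (sphere_measure :: 'a measure))"
    by (rule measurable_compose[OF measurable_fst measurable_sphere_to_borel])
  moreover have "snd \<in> borel_measurable (sphere_measure \<Otimes>\<^sub>M (sphere_measure :: 'a measure))"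
    by (rule measurable_compose[OF measurable_snd measurable_sphere_to_borel])
  ultimately show ?thesis by (rule borel_measurable_inner)
qed

text \<open>
  For a fixed \<open>x\<close> each of the countably many forbidden equations confines \<open>x \<bullet> z\<close> to a finite set,
  and hence \<open>z\<close> to a null set. Fubini's theorem exchanges the roles of \<open>x\<close> and \<open>z\<close>.
\<close>
lemma AE_AE_fresh:
  fixes y :: "nat \<Rightarrow> 'a::euclidean_space"
  assumes dim: "2 \<le> DIM('a)"
  shows "AE z in sphere_measure. AE x in sphere_measure.
           fresh m (\<lambda>j. upper_point (x \<bullet> y j)) (upper_point (x \<bullet> z))"
proof -
  interpret S: prob_space "sphere_measure :: 'a measure" by (rule prob_space_sphere_measure)
  interpret SS: pair_sigma_finite "sphere_measure :: 'a measure" "sphere_measure :: 'a measure" ..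
  have m1: "(\<lambda>p. upper_point (fst p \<bullet> snd p)) \<in> borel_measurable (sphere_measure \<Otimes>\<^sub>M (sphere_measure :: 'a measure))"
    by (rule measurable_compose[OF measurable_inner_sphere measurable_upper_point])
  have m2: "(\<lambda>p. upper_point (fst p \<bullet> y j)) \<in> borel_measurable (sphere_measure \<Otimes>\<^sub>M (sphere_measure :: 'a measure))" for j
    by (intro measurable_compose[OF _ measurable_upper_point] borel_measurable_inner
        measurable_compose[OF measurable_fst measurable_sphere_to_borel]) simp
  have m3: "(\<lambda>p. \<Prod>j<m. upper_point (fst p \<bullet> y j) powi as ! j) 
      \<in> borel_measurable (sphere_measure \<Otimes>\<^sub>M (sphere_measure :: 'a measure))" for as
    by (intro borel_measurable_prod measurable_power_int m2)
  have "AE x in sphere_measure. AE z in sphere_measure.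
           fresh m (\<lambda>j. upper_point (x \<bullet> y j)) (upper_point (x \<bullet> z))"
  proof (rule AE_I2)
    fix x :: 'a assume "x \<in> space sphere_measure"
    then have x: "norm x = 1" by simp
    show "AE z in sphere_measure. fresh m (\<lambda>j. upper_point (x \<bullet> y j)) (upper_point (x \<bullet> z))"
      unfolding fresh_def AE_all_countable
    proof (intro allI)
      fix k :: nat
      have "AE z in sphere_measure. \<forall>as. upper_point (x \<bullet> z) ^ k \<noteq> (\<Prod>j<m. upper_point (x \<bullet> y j) powi as ! j)"
        if "0 < k" unfolding AE_all_countable using AE_upper_point_power_neq[OF dim x that] by blast
      then show "AE z in sphere_measure. 0 < k \<longrightarrow>
         (\<forall>as. upper_point (x \<bullet> z) ^ k \<noteq> (\<Prod>j<m. upper_point (x \<bullet> y j) powi as ! j))"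
        by (cases "0 < k") auto
    qed
  qed
  moreover have "{p \<in> space (sphere_measure \<Otimes>\<^sub>M sphere_measure).
      fresh m (\<lambda>j. upper_point (fst p \<bullet> y j)) (upper_point (fst p \<bullet> snd p))}
        \<in> sets (sphere_measure \<Otimes>\<^sub>M (sphere_measure :: 'a measure))"
    unfolding fresh_def
    by (intro sets.sets_Collect_countable_All sets.sets_Collect_imp sets.sets_Collect_neg
        measurable_equality_set[OF borel_measurable_power[OF m1] m3] sets.sets_Collect_const)
  ultimately show ?thesis
    by (subst SS.AE_commute[symmetric]) auto
qed

text \<open>
  The points are chosen one after the other: the admissible choices of the next one have full
  measure, and each cap has positive measure.
\<close>
lemma exists_generic_points:
  fixes c :: "nat \<Rightarrow> 'a::euclidean_space"
  assumes dim: "2 \<le> DIM('a)" and c: "\<And>j. j < m \<Longrightarrow> norm (c j) = 1" and \<rho>: "0 < \<rho>"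
  shows "\<exists>y. (\<forall>j<m. norm (y j) = 1 \<and> dist (c j) (y j) < \<rho>) \<and>
           (AE x in sphere_measure. mult_indep {..<m} (\<lambda>j. upper_point (x \<bullet> y j)))"
  using c
proof (induction m)
  case 0
  show ?case by (auto simp: mult_indep_def)
next
  case (Suc m)
  interpret S: prob_space "sphere_measure :: 'a measure" by (rule prob_space_sphere_measure)
  obtain y where y: "\<forall>j<m. norm (y j) = 1 \<and> dist (c j) (y j) < \<rho>"
     "AE x in sphere_measure. mult_indep {..<m} (\<lambda>j. upper_point (x \<bullet> y j))"
    using Suc.IH Suc.prems by (meson less_SucI)
  let ?P = "\<lambda>z. AE x in sphere_measure. fresh m (\<lambda>j. upper_point (x \<bullet> y j)) (upper_point (x \<bullet> z))"
  have "\<exists>z\<in>cap (c m) \<rho>. ?P z"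
  proof (rule ccontr)
    assume "\<not> ?thesis"
    with AE_AE_fresh[OF dim, of m y] have "AE z in sphere_measure. z \<notin> cap (c m) \<rho>"
      by (auto elim: eventually_mono)
    then have "cap (c m) \<rho> \<in> null_sets sphere_measure"
      by (subst AE_iff_null_sets[OF sets_cap]) 
    then have 0: "measure sphere_measure (cap (c m) \<rho>) = 0" by (simp add: null_sets_def measure_def)
    have "0 < (min \<rho> 1) ^ (DIM('a) - 1) / 8 ^ (DIM('a) - 1 + 1)" using \<rho> by simp
    also have "\<dots> \<le> measure sphere_measure (cap (c m) (min \<rho> 1))"
      by (rule measure_cap_ge) (use \<rho> Suc.prems in auto)
    also have "\<dots> \<le> measure sphere_measure (cap (c m) \<rho>)"
      by (intro S.finite_measure_mono sets_cap) (auto simp: cap_def)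
    finally show False using 0 by simp
  qed
  then obtain z where z: "z \<in> cap (c m) \<rho>" "?P z" by blast
  define y' where "y' = y(m := z)"
  have "AE x in sphere_measure. mult_indep {..<Suc m} (\<lambda>j. upper_point (x \<bullet> y' j))"
    using y(2) z(2) AE_space
  proof eventually_elim
    case (elim x)
    have n1: "upper_point (x \<bullet> v) \<noteq> 0" if "norm v = 1" for v
      using norm_upper_point[OF inner_sphere_bound[of x v]] that elim(3) by auto
    have "mult_indep {..<m} (\<lambda>j. upper_point (x \<bullet> y' j)) \<longleftrightarrow> mult_indep {..<m} (\<lambda>j. upper_point (x \<bullet> y j))"
      unfolding mult_indep_def by (simp add: y'_def)
    moreover have "fresh m (\<lambda>j. upper_point (x \<bullet> y' j)) \<zeta> \<longleftrightarrow> fresh m (\<lambda>j. upper_point (x \<bullet> y j)) \<zeta>" for \<zeta>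
      unfolding fresh_def by (simp add: y'_def)
    ultimately show ?case
      using elim y(1) z(1) n1
      by (intro mult_indep_Suc) (auto simp: y'_def cap_def)
  qed
  moreover have "\<forall>j<Suc m. norm (y' j) = 1 \<and> dist (c j) (y' j) < \<rho>"
    using y(1) z(1) by (auto simp: y'_def cap_def less_Suc_eq)
  ultimately show ?case by blast
qed

text \<open>
  The terms with \<open>2\<^sup>k < 1 / d\<close> form a geometric progression, dominated by twice its last term.
\<close>
lemma dyadic_sum_le:
  fixes d :: real
  assumes d: "0 < d" and n: "1 \<le> n"
  shows "(\<Sum>k<K. 2 ^ (k * n) * of_bool (d < 1 / 2 ^ k)) \<le> 2 / d ^ n"
proof (induction K)
  case 0
  show ?case using d by simp
next
  case (Suc K)
  show ?case
  proof (cases "d < 1 / 2 ^ K")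
    case False
    then show ?thesis using Suc by simp
  next
    case True
    have n2: "(2::real) \<le> 2 ^ n" using n self_le_power[of "2::real" n] by simp
    have geo: "(\<Sum>k<K. (2::real) ^ (k * n)) \<le> 2 ^ (K * n)" for K
    proof (induction K)
      case (Suc K)
      have "(\<Sum>k<Suc K. (2::real) ^ (k * n)) \<le> 2 * 2 ^ (K * n)" using Suc by simp
      also have "\<dots> \<le> 2 ^ n * 2 ^ (K * n)" using n2 by (intro mult_right_mono) auto
      finally show ?case by (simp add: power_add)
    qed simp
    have "(\<Sum>k<Suc K. 2 ^ (k * n) * of_bool (d < 1 / 2 ^ k)) \<le> (\<Sum>k<Suc K. (2::real) ^ (k * n))"
      by (intro sum_mono) auto
    also have "\<dots> \<le> 2 * 2 ^ (K * n)" using geo[of K] by simp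
    also have "2 ^ (K * n) \<le> 1 / d ^ n"
    proof -
      have "2 ^ K \<le> 1 / d" using True d by (simp add: field_simps)
      then have "(2 ^ K) ^ n \<le> (1 / d) ^ n" by (intro power_mono) auto
      then show ?thesis by (simp add: power_mult power_one_over)
    qed
    finally show ?thesis by simp
  qed
qed

lemma exists_sphere_partition:
  fixes \<rho> :: real
  assumes "0 < \<rho>"
  shows "\<exists>(m::nat) c A. (\<forall>j<m. norm (c j) = 1 \<and> A j \<in> sets sphere_measure \<and> A j \<subseteq> ball (c j) \<rho>) \<and>
     disjoint_family_on A {..<m} \<and> (\<Union>j<m. A j) = sphere (0 :: 'a::euclidean_space) 1"
proof -
  have "sphere (0::'a) 1 \<subseteq> (\<Union>x\<in>sphere 0 1. ball x \<rho>)" using assms by auto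
  then obtain C where C: "C \<subseteq> sphere (0::'a) 1" "finite C" "sphere (0::'a) 1 \<subseteq> (\<Union>x\<in>C. ball x \<rho>)"
    by (meson compactE_image[OF compact_sphere] open_ball)
  obtain c and m :: nat where cm: "C = c ` {i. i < m}"
    using finite_imp_nat_seg_image_inj_on[OF C(2)] by metis
  define A where "A = disjointed (\<lambda>j. sphere (0::'a) 1 \<inter> ball (c j) \<rho>)"
  have "A j \<in> sets sphere_measure" for j
  proof (rule sets_sphere_measureI)
    show "A j \<in> sets borel" unfolding A_def disjointed_def by auto
    show "A j \<subseteq> sphere 0 1" unfolding A_def disjointed_def by auto
  qed
  moreover have "A j \<subseteq> ball (c j) \<rho>" for j unfolding A_def disjointed_def by auto
  moreover have "disjoint_family_on A {..<m}"
    using disjoint_family_disjointed[of "\<lambda>j. sphere (0::'a) 1 \<inter> ball (c j) \<rho>"]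
    unfolding A_def by (auto simp: disjoint_family_on_def)
  moreover have "(\<Union>j<m. A j) = sphere (0::'a) 1"
    using finite_UN_disjointed_eq[of "\<lambda>j. sphere (0::'a) 1 \<inter> ball (c j) \<rho>" m] C(3)
    unfolding A_def cm by (auto simp: atLeast0LessThan)
  moreover have "\<forall>j<m. norm (c j) = 1" using C(1) cm by auto
  ultimately show ?thesis by blast
qed

section \<open>Point masses with large means\<close>

text \<open>
  The critical order and the Gegenbauer index on the \<open>n\<close>-sphere are both \<open>(n - 1) / 2\<close>.
\<close>
abbreviation (input) critical_kernel :: "nat \<Rightarrow> nat \<Rightarrow> real \<Rightarrow> real" where
  "critical_kernel n \<equiv> cesaro_kernel ((real n - 1) / 2)"

abbreviation (input) critical_mean :: "nat \<Rightarrow> nat \<Rightarrow> ('a::euclidean_space \<Rightarrow> real) \<Rightarrow> 'a \<Rightarrow> real" where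
  "critical_mean n \<equiv> cesaro_mean n ((real n - 1) / 2)"

text \<open>
  A discretization of the uniform measure: cut the sphere into small pieces and move the measure of
  each piece to a point near it. Every dyadic annulus around \<open>x\<close> contributes to the integral of
  \<open>dist x y\<^sup>-\<^sup>n\<close> an amount that is bounded from below, so \<open>K\<close> scales give a bound of order \<open>K\<close> for all
  \<open>x\<close>. If the points are generic, the kernels act at almost every \<open>x\<close> as if all had the same sign.
\<close>
lemma exists_generic_point_masses:
  assumes dim: "DIM('a::euclidean_space) = n + 1" and n: "2 \<le> n"
  shows "\<exists>m (y :: nat \<Rightarrow> 'a) wt. (\<forall>j<m. norm (y j) = 1 \<and> 0 \<le> wt j) \<and> (\<Sum>j<m. wt j) = 1 \<and>
     (AE x in sphere_measure. \<forall>n0. \<exists>N\<ge>n0. B < \<bar>\<Sum>j<m. wt j * critical_kernel n N (x \<bullet> y j)\<bar>)"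
proof -
  interpret S: prob_space "sphere_measure :: 'a measure" by (rule prob_space_sphere_measure)
  let ?\<sigma> = "measure (sphere_measure :: 'a measure)"
  define l where "l = (real n - 1) / 2"
  have l: "0 < l" "2 * l + 1 = real n" using n by (auto simp: l_def field_simps)
  define \<kappa> where "\<kappa> = 2 powr (- l) / (2 * 16 ^ (n + 1) :: real)"
  have \<kappa>: "0 < \<kappa>" by (simp add: \<kappa>_def)
  obtain K :: nat where K: "B / \<kappa> < real K" using reals_Archimedean2 by blast
  \<comment> \<open>A point and the mass representing its piece are at most \<open>2 \<rho> = 2\<^sup>-\<^sup>K\<close> apart, which does not exceed any of the scales below.\<close>
  define \<rho> where "\<rho> = (1 / 2 :: real) ^ Suc K"
  have \<rho>: "0 < \<rho>" by (simp add: \<rho>_def)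
  obtain m :: nat and c and A :: "nat \<Rightarrow> 'a set" where part:
      "(\<forall>j<m. norm (c j) = 1 \<and> A j \<in> sets sphere_measure \<and> A j \<subseteq> ball (c j) \<rho>) \<and>
       disjoint_family_on A {..<m} \<and> (\<Union>j<m. A j) = sphere (0 :: 'a) 1"
    using exists_sphere_partition[OF \<rho>, where 'a = 'a] by (elim exE) (rule that)
  then have c: "\<And>j. j < m \<Longrightarrow> norm (c j) = 1" and A: "\<And>j. j < m \<Longrightarrow> A j \<in> sets sphere_measure"
    and Ac: "\<And>j. j < m \<Longrightarrow> A j \<subseteq> ball (c j) \<rho>"
    and disj: "disjoint_family_on A {..<m}" and UA: "(\<Union>j<m. A j) = sphere (0 :: 'a) 1"
    by auto
  have dim2: "2 \<le> DIM('a)" using dim n by simp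
  obtain y where y: "\<And>j. j < m \<Longrightarrow> norm (y j) = 1" "\<And>j. j < m \<Longrightarrow> dist (c j) (y j) < \<rho>"
     and gen: "AE x in sphere_measure. mult_indep {..<m} (\<lambda>j. upper_point (x \<bullet> y j))"
    using exists_generic_points[where c = c and m = m, OF dim2 _ \<rho>] c by metis
  define wt where "wt j = ?\<sigma> (A j)" for j
  have "(\<Sum>j<m. wt j) = ?\<sigma> (\<Union>j<m. A j)"
    unfolding wt_def using A disj by (intro S.finite_measure_finite_Union[symmetric]) auto
  also have "\<dots> = 1" unfolding UA using S.prob_space by simp
  finally have wt1: "(\<Sum>j<m. wt j) = 1" .
  have "AE x in sphere_measure. \<forall>n0. \<exists>N\<ge>n0. B < \<bar>\<Sum>j<m. wt j * critical_kernel n N (x \<bullet> y j)\<bar>"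
    using gen AE_space
  proof eventually_elim
    case (elim x)
    then have x: "norm x = 1" by simp
    define w where "w j = upper_point (x \<bullet> y j)" for j
    have w1: "norm (w j) = 1" if "j < m" for j
      unfolding w_def using norm_upper_point[OF inner_sphere_bound[OF x y(1)[OF that]]] .
    have wd: "norm (1 - w j) = dist x (y j)" if "j < m" for j
      unfolding w_def by (rule norm_one_minus_upper_point[OF x y(1)[OF that]])
    \<comment> \<open>The points themselves are excluded, since \<open>w j = 1\<close> is not independent.\<close>
    have d0: "0 < dist x (y j)" if j: "j < m" for j
    proof (rule ccontr)
      assume "\<not> ?thesis"
      then have "w j = 1" using wd[OF j] by auto
      then have "(\<Prod>i<m. w i powi (if i = j then 1 else 0)) = 1"
        by (intro prod.neutral) auto
      moreover have "mult_indep {..<m} w" using elim(1) by (simp add: w_def[abs_def])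
      ultimately show False using mult_indepD[of "{..<m}" w "\<lambda>i. if i = j then 1 else 0" j] j by simp
    qed
    have lower: "1 / (2 * 16 ^ (n + 1)) * real K \<le> (\<Sum>j<m. wt j * (1 / dist x (y j) ^ n))"
    proof -
      have cap_le: "(1 / 2 ^ Suc k) ^ n / 8 ^ (n + 1) \<le> (\<Sum>j<m. wt j * of_bool (dist x (y j) < 1 / 2 ^ k))"
        if k: "k < K" for k
      proof -
        have "(1 / 2 ^ Suc k) ^ n / 8 ^ (n + 1) \<le> ?\<sigma> (cap x (1 / 2 ^ Suc k))"
          by (rule measure_cap_ge[OF dim x]) (use one_le_power[of "2::real" "Suc k"] in \<open>auto simp: divide_le_eq\<close>)
        also have "\<dots> \<le> ?\<sigma> (\<Union>j\<in>{j. j < m \<and> dist x (y j) < 1 / 2 ^ k}. A j)"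
        proof (rule S.finite_measure_mono)
          show "cap x (1 / 2 ^ Suc k) \<subseteq> (\<Union>j\<in>{j. j < m \<and> dist x (y j) < 1 / 2 ^ k}. A j)"
          proof
            fix z assume z: "z \<in> cap x (1 / 2 ^ Suc k)"
            then have "z \<in> (\<Union>j<m. A j)" unfolding UA by (simp add: cap_def)
            then obtain j where j: "j < m" "z \<in> A j" by blast
            have "dist z (y j) < 2 * \<rho>"
              using Ac[OF j(1)] j(2) y(2)[OF j(1)] dist_triangle[of z "y j" "c j"]
              by (auto simp: dist_commute)
            also have "2 * \<rho> = (1 / 2) ^ K" by (simp add: \<rho>_def)
            also have "\<dots> \<le> (1 / 2) ^ Suc k" using k by (intro power_decreasing) auto
            finally have "dist z (y j) < 1 / 2 ^ Suc k" by (simp add: power_one_over)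
            moreover have "dist x z < 1 / 2 ^ Suc k" using z by (simp add: cap_def)
            ultimately have "dist x (y j) < 1 / 2 ^ Suc k + 1 / 2 ^ Suc k"
              using dist_triangle[of x "y j" z] by linarith
            then have "dist x (y j) < 1 / 2 ^ k" by simp
            then show "z \<in> (\<Union>j\<in>{j. j < m \<and> dist x (y j) < 1 / 2 ^ k}. A j)" using j by blast
          qed
        qed (use A in auto)
        also have "\<dots> \<le> (\<Sum>j\<in>{j. j < m \<and> dist x (y j) < 1 / 2 ^ k}. wt j)"
          unfolding wt_def using A by (intro S.finite_measure_subadditive_finite) auto
        also have "\<dots> = (\<Sum>j<m. wt j * of_bool (dist x (y j) < 1 / 2 ^ k))"
          by (rule sum.mono_neutral_cong_left) auto
        finally show ?thesis .
      qed
      have "1 / (2 * 16 ^ (n + 1)) * real K = (\<Sum>k<K. 1 / (2 * 16 ^ (n + 1)))" by simp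
      also have "\<dots> \<le> (\<Sum>k<K. 1 / 2 * (2 ^ (k * n) * (\<Sum>j<m. wt j * of_bool (dist x (y j) < 1 / 2 ^ k))))"
      proof (rule sum_mono)
        fix k assume "k \<in> {..<K}"
        then have "1 / 2 * (2 ^ (k * n) * ((1 / 2 ^ Suc k) ^ n / 8 ^ (n + 1))) \<le>
          1 / 2 * (2 ^ (k * n) * (\<Sum>j<m. wt j * of_bool (dist x (y j) < 1 / 2 ^ k)))"
          using cap_le by (intro mult_left_mono) auto
        moreover have "1 / (2 * 16 ^ (n + 1)) \<le> (1 / 2 * (2 ^ (k * n) * ((1 / 2 ^ Suc k) ^ n / 8 ^ (n + 1))) :: real)"
        proof -
          have "(1 / 2 * (2 ^ (k * n) * ((1 / 2 ^ Suc k) ^ n / 8 ^ (n + 1))) :: real) = 1 / (2 * (2 ^ n * 8 ^ (n + 1)))"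
            by (simp add: power_divide power_mult_distrib power_mult field_simps)
          moreover have "(2::real) ^ n * 8 ^ (n + 1) \<le> 2 ^ (n + 1) * 8 ^ (n + 1)" by simp
          moreover have "(2::real) ^ (n + 1) * 8 ^ (n + 1) = 16 ^ (n + 1)"
            unfolding power_mult_distrib[symmetric] by simp
          ultimately show ?thesis by (simp add: frac_le)
        qed
        ultimately show "1 / (2 * 16 ^ (n + 1)) \<le>
          1 / 2 * (2 ^ (k * n) * (\<Sum>j<m. wt j * of_bool (dist x (y j) < 1 / 2 ^ k)))" by linarith
      qed
      also have "\<dots> = (\<Sum>j<m. wt j * (1 / 2 * (\<Sum>k<K. 2 ^ (k * n) * of_bool (dist x (y j) < 1 / 2 ^ k))))"
        unfolding sum_distrib_left by (subst sum.swap) (simp only: mult_ac)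
      also have "\<dots> \<le> (\<Sum>j<m. wt j * (1 / 2 * (2 / dist x (y j) ^ n)))"
      proof (rule sum_mono)
        fix j assume "j \<in> {..<m}"
        then have "(\<Sum>k<K. 2 ^ (k * n) * of_bool (dist x (y j) < 1 / 2 ^ k)) \<le> 2 / dist x (y j) ^ n"
          using n by (intro dyadic_sum_le d0) auto
        then show "wt j * (1 / 2 * (\<Sum>k<K. 2 ^ (k * n) * of_bool (dist x (y j) < 1 / 2 ^ k))) \<le>
            wt j * (1 / 2 * (2 / dist x (y j) ^ n))"
          by (intro mult_left_mono) (auto simp: wt_def)
      qed
      finally show ?thesis by simp
    qed
    have "B < \<kappa> * real K" using K \<kappa> by (simp add: field_simps)
    also have "\<dots> = 2 powr (- l) * (1 / (2 * 16 ^ (n + 1)) * real K)" by (simp add: \<kappa>_def)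
    also have "\<dots> \<le> 2 powr (- l) * (\<Sum>j<m. wt j * (1 / dist x (y j) ^ n))"
      using lower by (intro mult_left_mono) auto
    also have "\<dots> = (\<Sum>j<m. wt j * (2 powr (- l) * norm (1 - w j) powr (- (2 * l + 1))))"
      unfolding sum_distrib_left
    proof (rule sum.cong[OF refl])
      fix j assume "j \<in> {..<m}"
      then have "norm (1 - w j) powr (- (2 * l + 1)) = 1 / dist x (y j) ^ n"
        using wd[of j] d0[of j] unfolding l by (simp add: powr_minus powr_realpow field_simps)
      then show "2 powr (- l) * (wt j * (1 / dist x (y j) ^ n)) =
           wt j * (2 powr (- l) * norm (1 - w j) powr (- (2 * l + 1)))" by simp
    qed
    finally have big: "B < (\<Sum>j<m. wt j * (2 powr (- l) * norm (1 - w j) powr (- (2 * l + 1))))" .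
    show ?case
    proof
      fix n0
      have "\<exists>N\<ge>n0. B < \<bar>\<Sum>j<m. wt j * cesaro_kernel l N (Re (w j))\<bar>"
        by (rule kernel_combination_large[OF l(1)])
           (use w1 elim(1) big in \<open>auto simp: wt_def w_def\<close>)
      then show "\<exists>N\<ge>n0. B < \<bar>\<Sum>j<m. wt j * critical_kernel n N (x \<bullet> y j)\<bar>"
        by (simp add: w_def l_def)
    qed
  qed
  then show ?thesis using y wt1 by (intro exI[of _ m] exI[of _ y] exI[of _ wt]) (auto simp: wt_def)
qed

section \<open>Cesaro means as kernel integrals\<close>

lemma continuous_on_gegenbauer: "continuous_on S (gegenbauer l k)"
proof (induction k rule: less_induct)
  case (less k)
  show ?case
  proof (cases k)
    case (Suc k')
    show ?thesis
    proof (cases k')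
      case 0
      have "gegenbauer l (Suc 0) = (\<lambda>t. 2 * l * t)" by auto
      then show ?thesis using Suc 0 by (simp add: continuous_intros)
    next
      case (Suc k'')
      have "gegenbauer l k = (\<lambda>t. (2 * (real k'' + 1 + l) * t * gegenbauer l (Suc k'') t
           - (real k'' + 2 * l) * gegenbauer l k'' t) / (real k'' + 2))"
        using \<open>k = Suc k'\<close> Suc by auto
      moreover have "continuous_on S (gegenbauer l (Suc k''))" "continuous_on S (gegenbauer l k'')"
        using less.IH \<open>k = Suc k'\<close> Suc by auto
      ultimately show ?thesis by (auto intro!: continuous_intros)
    qed
  next
    case 0
    then have "gegenbauer l k = (\<lambda>t. 1)" by auto
    then show ?thesis by simp
  qed
qed

lemma continuous_on_cesaro_kernel:
  assumes "0 < l" shows "continuous_on S (cesaro_kernel l N)"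
proof -
  have "cesaro_kernel l N = (\<lambda>t. (\<Sum>k=0..N. cesaro_coeff l (N - k) *
     ((real k + l) / l * gegenbauer l k t)) / cesaro_coeff l N)"
    by (auto simp: cesaro_kernel_def)
  moreover have "cesaro_coeff l N \<noteq> 0" using cesaro_coeff_pos[OF assms, of N] by simp
  ultimately show ?thesis using assms by (auto intro!: continuous_intros continuous_on_gegenbauer)
qed

lemma bounded_on_unit_interval:
  fixes k :: "real \<Rightarrow> real"
  assumes "continuous_on UNIV k"
  shows "\<exists>C\<ge>0. \<forall>t. \<bar>t\<bar> \<le> 1 \<longrightarrow> \<bar>k t\<bar> \<le> C"
proof -
  have "compact (k ` {-1..1})"
    using assms by (intro compact_continuous_image) (auto intro: continuous_on_subset)
  then obtain C where "\<forall>t\<in>k ` {-1..1}. norm t \<le> C"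
    using compact_imp_bounded bounded_iff by blast
  then have C: "\<bar>k t\<bar> \<le> C" if "\<bar>t\<bar> \<le> 1" for t using that by (auto simp: abs_le_iff)
  from C[of 0] show ?thesis by (intro exI[of _ C]) (auto intro: C)
qed

lemma measurable_kernel_inner:
  fixes k :: "real \<Rightarrow> real" and x :: "'a::euclidean_space"
  assumes "continuous_on UNIV k"
  shows "(\<lambda>y. k (x \<bullet> y)) \<in> borel_measurable (sphere_measure :: 'a measure)"
    and "(\<lambda>y. k (y \<bullet> x)) \<in> borel_measurable (sphere_measure :: 'a measure)"
  using borel_measurable_continuous_onI[OF assms] measurable_sphere_to_borel
  by (auto intro!: measurable_compose[of _ _ borel k] borel_measurable_inner)

lemma integrable_kernel_mult:
  fixes x :: "'a::euclidean_space"
  assumes k: "continuous_on UNIV k" and f: "integrable sphere_measure f" and x: "norm x = 1"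
  shows "integrable sphere_measure (\<lambda>y. k (x \<bullet> y) * f y :: real)"
proof -
  obtain C where C: "0 \<le> C" "\<And>t. \<bar>t\<bar> \<le> 1 \<Longrightarrow> \<bar>k t\<bar> \<le> C" using bounded_on_unit_interval[OF k] by blast
  show ?thesis
  proof (rule Bochner_Integration.integrable_bound)
    show "integrable sphere_measure (\<lambda>y. C * f y)" using f by simp
    show "(\<lambda>y. k (x \<bullet> y) * f y) \<in> borel_measurable sphere_measure"
      using measurable_kernel_inner(1)[OF k] f by (intro borel_measurable_times) auto
    show "AE y in sphere_measure. norm (k (x \<bullet> y) * f y) \<le> norm (C * f y)"
    proof (rule AE_I2)
      fix y :: 'a assume "y \<in> space sphere_measure"
      then have "\<bar>k (x \<bullet> y)\<bar> \<le> C" using x by (intro C inner_sphere_bound) auto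
      then show "norm (k (x \<bullet> y) * f y) \<le> norm (C * f y)"
        using C(1) by (auto simp: abs_mult intro: mult_right_mono)
    qed
  qed
qed

lemma cesaro_mean_eq_kernel_integral:
  fixes x :: "'a::euclidean_space"
  assumes n: "2 \<le> n" and f: "integrable sphere_measure f" and x: "norm x = 1"
  shows "critical_mean n N f x = (LINT y|sphere_measure. critical_kernel n N (x \<bullet> y) * f y)"
proof -
  define l where "l = (real n - 1) / 2"
  have int: "integrable sphere_measure (\<lambda>y. gegenbauer l k (x \<bullet> y) * f y)" for k
    by (rule integrable_kernel_mult[OF continuous_on_gegenbauer f x])
  have p: "sph_proj n k f x = (real k + l) / l * (LINT y|sphere_measure. gegenbauer l k (x \<bullet> y) * f y)" for k
    unfolding sph_proj_def zonal_def Let_def l_def[symmetric] by (simp add: mult.assoc)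
  have "critical_mean n N f x = (\<Sum>k=0..N. cesaro_coeff l (N - k) * ((real k + l) / l) / cesaro_coeff l N *
      (LINT y|sphere_measure. gegenbauer l k (x \<bullet> y) * f y))"
    unfolding cesaro_mean_def p l_def[symmetric] sum_divide_distrib by (intro sum.cong) auto
  also have "\<dots> = (\<Sum>k=0..N. (LINT y|sphere_measure. cesaro_coeff l (N - k) * ((real k + l) / l) / cesaro_coeff l N *
      (gegenbauer l k (x \<bullet> y) * f y)))"
    by simp
  also have "\<dots> = (LINT y|sphere_measure. (\<Sum>k=0..N. cesaro_coeff l (N - k) * ((real k + l) / l) / cesaro_coeff l N *
      (gegenbauer l k (x \<bullet> y) * f y)))"
    using int by (intro Bochner_Integration.integral_sum[symmetric]) auto
  also have "\<dots> = (LINT y|sphere_measure. cesaro_kernel l N (x \<bullet> y) * f y)"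
    unfolding cesaro_kernel_def sum_distrib_right sum_divide_distrib
    by (intro Bochner_Integration.integral_cong sum.cong refl) simp
  finally show ?thesis by (simp only: l_def)
qed

lemma measurable_critical_mean:
  fixes f :: "'a::euclidean_space \<Rightarrow> real"
  assumes f: "f \<in> borel_measurable sphere_measure"
  shows "critical_mean n N f \<in> borel_measurable sphere_measure"
proof -
  interpret S: prob_space "sphere_measure :: 'a measure" by (rule prob_space_sphere_measure)
  have "(\<lambda>x. sph_proj n k f x) \<in> borel_measurable sphere_measure" for k
    unfolding sph_proj_def
  proof (rule S.borel_measurable_lebesgue_integral)
    have g: "gegenbauer l k \<in> borel_measurable borel" for l
      by (intro borel_measurable_continuous_onI continuous_on_gegenbauer)
    have "(\<lambda>p. f (snd p)) \<in> borel_measurable ((sphere_measure :: 'a measure) \<Otimes>\<^sub>M sphere_measure)"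
      by (rule measurable_compose[OF measurable_snd f])
    then show "(\<lambda>(x, y). zonal n k x y * f y) \<in> borel_measurable ((sphere_measure :: 'a measure) \<Otimes>\<^sub>M sphere_measure)"
      unfolding zonal_def Let_def split_beta
      by (intro borel_measurable_times borel_measurable_const measurable_compose[OF measurable_inner_sphere g])
  qed
  then show ?thesis
    unfolding cesaro_mean_def[abs_def] by (intro borel_measurable_divide borel_measurable_sum borel_measurable_times) auto
qed

lemma critical_mean_add_scaled:
  fixes x :: "'a::euclidean_space"
  assumes n: "2 \<le> n" and h: "integrable sphere_measure h" and g: "integrable sphere_measure g"
    and x: "norm x = 1"
  shows "critical_mean n N (\<lambda>y. h y + c * g y) x = critical_mean n N h x + c * critical_mean n N g x"
proof -
  have k: "continuous_on UNIV (critical_kernel n N)" using n by (intro continuous_on_cesaro_kernel) auto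
  have "integrable sphere_measure (\<lambda>y. h y + c * g y)" using h g by simp
  note [simp] = cesaro_mean_eq_kernel_integral[OF n this x] cesaro_mean_eq_kernel_integral[OF n h x]
    cesaro_mean_eq_kernel_integral[OF n g x]
  have "(LINT y|sphere_measure. critical_kernel n N (x \<bullet> y) * (h y + c * g y)) =
     (LINT y|sphere_measure. critical_kernel n N (x \<bullet> y) * h y + c * (critical_kernel n N (x \<bullet> y) * g y))"
    by (intro Bochner_Integration.integral_cong refl) (simp add: algebra_simps)
  also have "\<dots> = (LINT y|sphere_measure. critical_kernel n N (x \<bullet> y) * h y) +
      c * (LINT y|sphere_measure. critical_kernel n N (x \<bullet> y) * g y)"
    using integrable_kernel_mult[OF k h x] integrable_kernel_mult[OF k g x] by simp
  finally show ?thesis by simp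
qed

section \<open>Integrable functions with large means\<close>

lemma uniform_modulus:
  fixes k :: "nat \<Rightarrow> real \<Rightarrow> real"
  assumes "\<And>N. continuous_on UNIV (k N)"
  shows "\<exists>s>0. \<forall>N\<le>M. \<forall>t u. \<bar>t\<bar> \<le> 1 \<longrightarrow> \<bar>u\<bar> \<le> 1 \<longrightarrow> \<bar>t - u\<bar> < s \<longrightarrow> \<bar>k N t - k N u\<bar> \<le> 1"
proof -
  have "\<exists>s>0. \<forall>t u. \<bar>t\<bar> \<le> 1 \<longrightarrow> \<bar>u\<bar> \<le> 1 \<longrightarrow> \<bar>t - u\<bar> < s \<longrightarrow> \<bar>k N t - k N u\<bar> \<le> 1" for N
  proof -
    have "uniformly_continuous_on {-1..1} (k N)"
      by (intro compact_uniformly_continuous continuous_on_subset[OF assms]) auto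
    then obtain s where "s > 0" "\<forall>t\<in>{-1..1}. \<forall>u\<in>{-1..1}. dist u t < s \<longrightarrow> dist (k N u) (k N t) < 1"
      unfolding uniformly_continuous_on_def by (metis zero_less_one)
    then show ?thesis by (intro exI[of _ s]) (force simp: dist_real_def abs_le_iff)
  qed
  then obtain s where s: "\<And>N. s N > 0"
    "\<And>N t u. \<bar>t\<bar> \<le> 1 \<Longrightarrow> \<bar>u\<bar> \<le> 1 \<Longrightarrow> \<bar>t - u\<bar> < s N \<Longrightarrow> \<bar>k N t - k N u\<bar> \<le> 1" by metis
  show ?thesis
  proof (intro exI[of _ "Min (s ` {..M})"] conjI allI impI)
    show "0 < Min (s ` {..M})" using s(1) by simp
    fix N t u assume "N \<le> M" "\<bar>t\<bar> \<le> 1" "\<bar>u\<bar> \<le> 1" "\<bar>t - u\<bar> < Min (s ` {..M})"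
    then show "\<bar>k N t - k N u\<bar> \<le> 1" by (intro s(2)) auto
  qed
qed

lemma cap_average_close:
  fixes x :: "'a::euclidean_space"
  assumes k: "continuous_on UNIV k" and x: "norm x = 1" and p: "0 < measure sphere_measure (cap z s)"
    and close: "\<And>y. y \<in> cap z s \<Longrightarrow> \<bar>k (x \<bullet> y) - v\<bar> \<le> 1"
  shows "\<bar>(LINT y|sphere_measure. k (x \<bullet> y) * (indicator (cap z s) y / measure sphere_measure (cap z s))) - v\<bar> \<le> 1"
proof -
  interpret S: prob_space "sphere_measure :: 'a measure" by (rule prob_space_sphere_measure)
  define \<mu> where "\<mu> = measure sphere_measure (cap z s)"
  define \<phi> where "\<phi> y = indicator (cap z s) y / \<mu>" for y
  have \<phi>: "integrable sphere_measure \<phi>"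
    unfolding \<phi>_def by (intro integrable_divide integrable_real_indicator) (auto simp: S.emeasure_finite less_top[symmetric])
  have i1: "(LINT y|sphere_measure. \<phi> y) = 1"
  proof -
    have "cap z s \<inter> sphere 0 1 = cap z s" by (auto simp: cap_def)
    then show ?thesis unfolding \<phi>_def using p by (simp add: \<mu>_def)
  qed
  have int: "integrable sphere_measure (\<lambda>y. k (x \<bullet> y) * \<phi> y)" by (rule integrable_kernel_mult[OF k \<phi> x])
  have "(LINT y|sphere_measure. k (x \<bullet> y) * \<phi> y) - v
       = (LINT y|sphere_measure. k (x \<bullet> y) * \<phi> y) - (LINT y|sphere_measure. v * \<phi> y)"
    using i1 by simp
  also have "\<dots> = (LINT y|sphere_measure. k (x \<bullet> y) * \<phi> y - v * \<phi> y)"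
    using int \<phi> by (intro Bochner_Integration.integral_diff[symmetric]) auto
  also have "\<bar>\<dots>\<bar> \<le> (LINT y|sphere_measure. \<phi> y)"
  proof (rule integral_abs_bound_integral)
    fix y :: 'a
    have "\<bar>k (x \<bullet> y) * \<phi> y - v * \<phi> y\<bar> = \<bar>k (x \<bullet> y) - v\<bar> * \<phi> y"
    proof -
      have "0 \<le> \<phi> y" using p by (simp add: \<phi>_def \<mu>_def)
      moreover have "k (x \<bullet> y) * \<phi> y - v * \<phi> y = (k (x \<bullet> y) - v) * \<phi> y"
        by (simp only: left_diff_distrib)
      ultimately show ?thesis by (simp add: abs_mult)
    qed
    also have "\<dots> \<le> 1 * \<phi> y"
      using close[of y] p by (cases "y \<in> cap z s") (auto simp: \<phi>_def \<mu>_def intro!: divide_right_mono)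
    finally show "\<bar>k (x \<bullet> y) * \<phi> y - v * \<phi> y\<bar> \<le> \<phi> y" by simp
  qed (use int \<phi> in auto)
  finally show ?thesis using i1 by (simp add: \<phi>_def \<mu>_def)
qed

text \<open>
  Finitely many indices \<open>N\<close> suffice for all \<open>x\<close> outside a set of measure \<open>\<epsilon>\<close>. For finitely many \<open>N\<close>
  the kernels have a common modulus of continuity, so that every point mass can be replaced by the
  normalized indicator function of a small cap at the cost of an error of at most \<open>1\<close>.
\<close>
lemma exists_large_function:
  assumes dim: "DIM('a::euclidean_space) = n + 1" and n: "2 \<le> n" and \<epsilon>: "0 < \<epsilon>"
  shows "\<exists>(g :: 'a \<Rightarrow> real) N1. integrable sphere_measure g \<and> (LINT y|sphere_measure. \<bar>g y\<bar>) \<le> 1 \<and>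
     1 - \<epsilon> \<le> measure sphere_measure {x \<in> space sphere_measure. \<exists>N\<in>{n0..N1}. B < \<bar>critical_mean n N g x\<bar>}"
proof -
  interpret S: prob_space "sphere_measure :: 'a measure" by (rule prob_space_sphere_measure)
  obtain m and y :: "nat \<Rightarrow> 'a" and wt where y: "\<And>j. j < m \<Longrightarrow> norm (y j) = 1"
    and wt: "\<And>j. j < m \<Longrightarrow> 0 \<le> wt j" "(\<Sum>j<m. wt j) = 1"
    and large: "AE x in sphere_measure. \<forall>n0. \<exists>N\<ge>n0. B + 1 < \<bar>\<Sum>j<m. wt j * critical_kernel n N (x \<bullet> y j)\<bar>"
    using exists_generic_point_masses[OF dim n, of "B + 1"] by blast
  have k: "continuous_on UNIV (critical_kernel n N)" for N
    using n by (intro continuous_on_cesaro_kernel) auto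
  define P where "P N x = (\<Sum>j<m. wt j * critical_kernel n N (x \<bullet> y j))" for N x
  have P: "P N \<in> borel_measurable sphere_measure" for N
    unfolding P_def[abs_def]
    by (intro borel_measurable_sum borel_measurable_times measurable_kernel_inner(2)[OF k]) auto
  define E where "E i = {x \<in> space sphere_measure. \<exists>N\<in>{n0..n0 + i}. B + 1 < \<bar>P N x\<bar>}" for i
  have E: "E i \<in> sets sphere_measure" for i
  proof -
    have "E i = (\<Union>N\<in>{n0..n0 + i}. {x \<in> space sphere_measure. B + 1 < \<bar>P N x\<bar>})"
      by (auto simp: E_def)
    also have "\<dots> \<in> sets sphere_measure"
      using P by (intro sets.finite_UN borel_measurable_less) auto
    finally show ?thesis .
  qed
  have "(\<lambda>i. measure sphere_measure (E i)) \<longlonglongrightarrow> measure sphere_measure (\<Union>i. E i)"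
    using E by (intro S.finite_Lim_measure_incseq) (auto simp: incseq_def E_def)
  also have "measure sphere_measure (\<Union>i. E i) = 1"
  proof -
    have "AE x in sphere_measure. x \<in> (\<Union>i. E i)"
      using large AE_space
    proof eventually_elim
      case (elim x)
      then obtain N where "N \<ge> n0" "B + 1 < \<bar>P N x\<bar>" unfolding P_def by blast
      then show ?case using elim(2) unfolding E_def by (auto intro!: exI[of _ "N - n0"] bexI[of _ N])
    qed
    then show ?thesis using E by (subst S.prob_eq_1) auto
  qed
  finally have "eventually (\<lambda>i. 1 - \<epsilon> < measure sphere_measure (E i)) sequentially"
    using \<epsilon> by (intro order_tendstoD(1)[of _ 1]) auto
  then obtain i where i: "1 - \<epsilon> < measure sphere_measure (E i)"
    by (auto simp: eventually_sequentially)
  obtain s where s: "0 < s" and mod: "\<And>N t u. N \<le> n0 + i \<Longrightarrow> \<bar>t\<bar> \<le> 1 \<Longrightarrow> \<bar>u\<bar> \<le> 1 \<Longrightarrow> \<bar>t - u\<bar> < s \<Longrightarrow>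
      \<bar>critical_kernel n N t - critical_kernel n N u\<bar> \<le> 1"
    using uniform_modulus[of "critical_kernel n" "n0 + i", OF k] by metis
  define \<phi> where "\<phi> j z = indicator (cap (y j) s) z / measure sphere_measure (cap (y j) s)" for j z
  have pos: "0 < measure sphere_measure (cap (y j) s)" if "j < m" for j
  proof -
    have "0 < (min s 1) ^ n / 8 ^ (n + 1)" using s by simp
    also have "\<dots> \<le> measure sphere_measure (cap (y j) (min s 1))"
      by (rule measure_cap_ge[OF dim]) (use s y that in auto)
    also have "\<dots> \<le> measure sphere_measure (cap (y j) s)"
      by (intro S.finite_measure_mono sets_cap) (auto simp: cap_def)
    finally show ?thesis .
  qed
  have \<phi>: "integrable sphere_measure (\<phi> j)" for j
    unfolding \<phi>_def[abs_def]
    by (intro integrable_divide integrable_real_indicator) (auto simp: S.emeasure_finite less_top[symmetric])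
  have \<phi>0: "0 \<le> \<phi> j z" for j z by (simp add: \<phi>_def)
  have i1: "(LINT z|sphere_measure. \<phi> j z) = 1" if "j < m" for j
  proof -
    have "cap (y j) s \<inter> sphere 0 1 = cap (y j) s" by (auto simp: cap_def)
    then show ?thesis unfolding \<phi>_def using pos[OF that] by simp
  qed
  define g where "g z = (\<Sum>j<m. wt j * \<phi> j z)" for z
  have g: "integrable sphere_measure g" unfolding g_def[abs_def] using \<phi> by auto
  have "(LINT z|sphere_measure. \<bar>g z\<bar>) = (LINT z|sphere_measure. g z)"
    using wt(1) \<phi>0 by (intro Bochner_Integration.integral_cong refl abs_of_nonneg)
      (auto simp: g_def intro!: sum_nonneg)
  also have "\<dots> = (\<Sum>j<m. wt j * (LINT z|sphere_measure. \<phi> j z))"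
    unfolding g_def using \<phi> by simp
  also have "\<dots> = 1" using i1 wt(2) by simp
  finally have norm_g: "(LINT z|sphere_measure. \<bar>g z\<bar>) = 1" .
  have close: "\<bar>critical_mean n N g x - P N x\<bar> \<le> 1" if x: "norm x = 1" and N: "N \<le> n0 + i" for N x
  proof -
    let ?I = "\<lambda>j. LINT z|sphere_measure. critical_kernel n N (x \<bullet> z) * \<phi> j z"
    have "critical_mean n N g x = (LINT z|sphere_measure. critical_kernel n N (x \<bullet> z) * g z)"
      by (rule cesaro_mean_eq_kernel_integral[OF n g x])
    also have "\<dots> = (LINT z|sphere_measure. (\<Sum>j<m. wt j * (critical_kernel n N (x \<bullet> z) * \<phi> j z)))"
      unfolding g_def sum_distrib_left
      by (intro Bochner_Integration.integral_cong sum.cong refl mult.left_commute)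
    also have "\<dots> = (\<Sum>j<m. wt j * ?I j)"
      using integrable_kernel_mult[OF k \<phi> x] by simp
    finally have "critical_mean n N g x - P N x = (\<Sum>j<m. wt j * (?I j - critical_kernel n N (x \<bullet> y j)))"
      by (simp add: P_def right_diff_distrib sum_subtractf)
    also have "\<bar>\<dots>\<bar> \<le> (\<Sum>j<m. wt j * 1)"
    proof (rule order_trans[OF sum_abs], rule sum_mono)
      fix j assume "j \<in> {..<m}"
      then have j: "j < m" by simp
      have "\<bar>?I j - critical_kernel n N (x \<bullet> y j)\<bar> \<le> 1"
        unfolding \<phi>_def
      proof (rule cap_average_close[OF k x pos[OF j]])
        fix z assume "z \<in> cap (y j) s"
        then have z: "norm z = 1" "dist (y j) z < s" by (auto simp: cap_def)
        have "\<bar>x \<bullet> z - x \<bullet> y j\<bar> \<le> norm x * norm (z - y j)"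
          unfolding inner_diff_right[symmetric] by (rule Cauchy_Schwarz_ineq2)
        also have "\<dots> < s" using x z(2) by (simp add: dist_norm norm_minus_commute)
        finally show "\<bar>critical_kernel n N (x \<bullet> z) - critical_kernel n N (x \<bullet> y j)\<bar> \<le> 1"
          using N x z(1) y[OF j] by (intro mod inner_sphere_bound)
      qed
      then show "\<bar>wt j * (?I j - critical_kernel n N (x \<bullet> y j))\<bar> \<le> wt j * 1"
        using wt(1)[OF j] unfolding abs_mult by (simp add: mult_left_le)
    qed
    finally show ?thesis using wt(2) by simp
  qed
  let ?G = "{x \<in> space sphere_measure. \<exists>N\<in>{n0..n0 + i}. B < \<bar>critical_mean n N g x\<bar>}"
  have "?G = (\<Union>N\<in>{n0..n0 + i}. {x \<in> space sphere_measure. B < \<bar>critical_mean n N g x\<bar>})" by auto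
  also have "\<dots> \<in> sets sphere_measure"
    using measurable_critical_mean[of g n] g by (intro sets.finite_UN borel_measurable_less) auto
  finally have "?G \<in> sets sphere_measure" .
  moreover have "E i \<subseteq> ?G"
  proof
    fix x assume "x \<in> E i"
    then obtain N where N: "x \<in> space sphere_measure" "N \<in> {n0..n0 + i}" "B + 1 < \<bar>P N x\<bar>"
      by (auto simp: E_def)
    have "\<bar>critical_mean n N g x - P N x\<bar> \<le> 1" using N(1,2) by (intro close) auto
    then have "B < \<bar>critical_mean n N g x\<bar>" using N(3) by linarith
    then show "x \<in> ?G" using N by blast
  qed
  ultimately have "measure sphere_measure (E i) \<le> measure sphere_measure ?G"
    by (intro S.finite_measure_mono)
  with i have "1 - \<epsilon> \<le> measure sphere_measure ?G" by linarith
  then show ?thesis using g norm_g by (intro exI[of _ g] exI[of _ "n0 + i"]) auto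
qed

text \<open>
  Adding a function with large means to \<open>h\<close> could lead to cancellation with the means of \<open>h\<close>. So
  consider the perturbations \<open>\<omega> a g\<^sub>0\<close> for \<open>\<omega> = 1, \<dots>, m\<close>. If the means of \<open>g\<^sub>0\<close> exceed \<open>2 M / a\<close> at
  \<open>x\<close>, then cancellation at \<open>x\<close> happens for at most one \<open>\<omega>\<close>; hence for some \<open>\<omega>\<close> it happens only on a
  set of measure at most \<open>1 / m\<close>.
\<close>
lemma exists_perturbation:
  fixes h :: "'a::euclidean_space \<Rightarrow> real"
  assumes dim: "DIM('a) = n + 1" and n: "2 \<le> n" and h: "integrable sphere_measure h"
    and \<epsilon>: "0 < \<epsilon>" and \<eta>: "0 < \<eta>" and M: "0 \<le> M"
  shows "\<exists>g N1. integrable sphere_measure g \<and> (LINT y|sphere_measure. \<bar>g y\<bar>) \<le> \<eta> \<and>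
     1 - \<epsilon> \<le> measure sphere_measure
       {x \<in> space sphere_measure. \<exists>N\<in>{n0..N1}. M < \<bar>critical_mean n N (\<lambda>y. h y + g y) x\<bar>}"
proof -
  interpret S: prob_space "sphere_measure :: 'a measure" by (rule prob_space_sphere_measure)
  \<comment> \<open>Half of \<open>\<epsilon>\<close> is for the points where \<open>g\<^sub>0\<close> has small means, half for cancellation.\<close>
  obtain m :: nat where m: "2 / \<epsilon> < real m" using reals_Archimedean2 by blast
  have m0: "0 < m" "1 / real m \<le> \<epsilon> / 2"
  proof -
    have "0 < 2 / \<epsilon>" using \<epsilon> by simp
    then have "0 < real m" using m by linarith
    then show "0 < m" "1 / real m \<le> \<epsilon> / 2" using m \<epsilon> by (auto simp: field_simps)
  qed
  define a where "a = \<eta> / real m"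
  have a: "0 < a" using \<eta> m0 by (simp add: a_def)
  obtain g0 :: "'a \<Rightarrow> real" and N1 where g0: "integrable sphere_measure g0"
      "(LINT y|sphere_measure. \<bar>g0 y\<bar>) \<le> 1" and
    E: "1 - \<epsilon> / 2 \<le> measure sphere_measure {x \<in> space sphere_measure. \<exists>N\<in>{n0..N1}. 2 * M / a < \<bar>critical_mean n N g0 x\<bar>}"
    using exists_large_function[OF dim n, of "\<epsilon> / 2" n0 "2 * M / a"] \<epsilon> by auto
  have meas: "{x \<in> space sphere_measure. \<exists>N\<in>{n0..N1}. c < \<bar>critical_mean n N f x\<bar>} \<in> sets sphere_measure"
    if "integrable sphere_measure f" for c and f :: "'a \<Rightarrow> real"
  proof -
    have "{x \<in> space sphere_measure. \<exists>N\<in>{n0..N1}. c < \<bar>critical_mean n N f x\<bar>} =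
       (\<Union>N\<in>{n0..N1}. {x \<in> space sphere_measure. c < \<bar>critical_mean n N f x\<bar>})" by auto
    also have "\<dots> \<in> sets sphere_measure"
      using measurable_critical_mean[of f n] that by (intro sets.finite_UN borel_measurable_less) auto
    finally show ?thesis .
  qed
  define E0 where "E0 = {x \<in> space sphere_measure. \<exists>N\<in>{n0..N1}. 2 * M / a < \<bar>critical_mean n N g0 x\<bar>}"
  define F where "F \<omega> = (\<lambda>y. h y + (real \<omega> * a) * g0 y)" for \<omega> :: nat
  define G where "G \<omega> = {x \<in> space sphere_measure. \<exists>N\<in>{n0..N1}. M < \<bar>critical_mean n N (F \<omega>) x\<bar>}" for \<omega>
  have E0: "E0 \<in> sets sphere_measure" unfolding E0_def by (rule meas[OF g0(1)])
  have G: "G \<omega> \<in> sets sphere_measure" for \<omega>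
    unfolding G_def by (rule meas) (use h g0 in \<open>auto simp: F_def\<close>)
  have "disjoint_family_on (\<lambda>\<omega>. E0 - G \<omega>) {1..m}"
    unfolding disjoint_family_on_def
  proof (intro ballI impI)
    fix \<omega> \<omega>' :: nat assume ne: "\<omega> \<noteq> \<omega>'"
    show "(E0 - G \<omega>) \<inter> (E0 - G \<omega>') = {}"
    proof (rule ccontr)
      assume "(E0 - G \<omega>) \<inter> (E0 - G \<omega>') \<noteq> {}"
      then obtain x where x: "x \<in> E0" "x \<notin> G \<omega>" "x \<notin> G \<omega>'" by blast
      then obtain N where N: "N \<in> {n0..N1}" "2 * M / a < \<bar>critical_mean n N g0 x\<bar>"
        and x1: "x \<in> space sphere_measure" by (auto simp: E0_def)
      then have nx: "norm x = 1" by simp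
      let ?t = "critical_mean n N g0 x" and ?u = "critical_mean n N h x"
      have F: "critical_mean n N (F \<omega>) x = ?u + real \<omega> * a * ?t" for \<omega>
        unfolding F_def by (rule critical_mean_add_scaled[OF n h g0(1) nx])
      have "\<bar>critical_mean n N (F \<omega>) x\<bar> \<le> M" "\<bar>critical_mean n N (F \<omega>') x\<bar> \<le> M"
        using x(2,3) x1 N(1) unfolding G_def by (auto simp: not_less)
      then have "\<bar>?u + real \<omega> * a * ?t\<bar> \<le> M" "\<bar>?u + real \<omega>' * a * ?t\<bar> \<le> M"
        unfolding F .
      then have "\<bar>(?u + real \<omega> * a * ?t) - (?u + real \<omega>' * a * ?t)\<bar> \<le> 2 * M" by linarith
      also have "(?u + real \<omega> * a * ?t) - (?u + real \<omega>' * a * ?t) = (real \<omega> - real \<omega>') * (a * ?t)"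
        by (simp add: algebra_simps)
      finally have "\<bar>real \<omega> - real \<omega>'\<bar> * \<bar>a * ?t\<bar> \<le> 2 * M" by (simp add: abs_mult)
      moreover have "1 \<le> \<bar>real \<omega> - real \<omega>'\<bar>" using ne by linarith
      then have "1 * \<bar>a * ?t\<bar> \<le> \<bar>real \<omega> - real \<omega>'\<bar> * \<bar>a * ?t\<bar>" by (rule mult_right_mono) simp
      moreover have "2 * M < \<bar>a * ?t\<bar>" using N(2) a by (simp add: abs_mult field_simps)
      ultimately show False by linarith
    qed
  qed
  then have "(\<Sum>\<omega>\<in>{1..m}. measure sphere_measure (E0 - G \<omega>)) = measure sphere_measure (\<Union>\<omega>\<in>{1..m}. E0 - G \<omega>)"
    using E0 G by (intro S.finite_measure_finite_Union[symmetric]) auto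
  also have "\<dots> \<le> 1" by (rule S.prob_le_1)
  finally have sum1: "(\<Sum>\<omega>\<in>{1..m}. measure sphere_measure (E0 - G \<omega>)) \<le> 1" .
  obtain \<omega> where \<omega>: "\<omega> \<in> {1..m}" "measure sphere_measure (E0 - G \<omega>) \<le> 1 / real m"
  proof (rule ccontr)
    assume "\<not> thesis"
    then have "\<And>\<omega>. \<omega> \<in> {1..m} \<Longrightarrow> 1 / real m < measure sphere_measure (E0 - G \<omega>)"
      using that by (meson not_le)
    then have "(\<Sum>\<omega>\<in>{1..m}. 1 / real m) < (\<Sum>\<omega>\<in>{1..m}. measure sphere_measure (E0 - G \<omega>))"
      using m0 by (intro sum_strict_mono) auto
    then show False using sum1 m0 by simp
  qed
  have "measure sphere_measure E0 \<le> measure sphere_measure (G \<omega> \<union> (E0 - G \<omega>))"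
    using E0 G by (intro S.finite_measure_mono) auto
  also have "\<dots> \<le> measure sphere_measure (G \<omega>) + measure sphere_measure (E0 - G \<omega>)"
    using E0 G by (intro measure_Un_le) auto
  finally have "1 - \<epsilon> \<le> measure sphere_measure (G \<omega>)"
    using E \<omega>(2) m0(2) unfolding E0_def by linarith
  moreover have "integrable sphere_measure (\<lambda>y. (real \<omega> * a) * g0 y)" using g0 by simp
  moreover have "(LINT y|sphere_measure. \<bar>(real \<omega> * a) * g0 y\<bar>) \<le> \<eta>"
  proof -
    have "(LINT y|sphere_measure. \<bar>(real \<omega> * a) * g0 y\<bar>) = (real \<omega> * a) * (LINT y|sphere_measure. \<bar>g0 y\<bar>)"
      using a by (simp add: abs_mult)
    also have "\<dots> \<le> (real m * a) * 1"
      using a \<omega>(1) g0(2) by (intro mult_mono mult_right_mono) auto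
    also have "\<dots> = \<eta>" using m0 by (simp add: a_def)
    finally show ?thesis .
  qed
  ultimately show ?thesis unfolding G_def F_def by blast
qed

section \<open>The divergent series of perturbations\<close>

lemma integrable_series:
  fixes g :: "nat \<Rightarrow> 'b \<Rightarrow> real"
  assumes g: "\<And>i. integrable M (g i)" and s: "summable (\<lambda>i. LINT y|M. \<bar>g i y\<bar>)"
  shows "AE y in M. summable (\<lambda>i. \<bar>g i y\<bar>)" and "integrable M (\<lambda>y. \<Sum>i. g i y)"
proof -
  have [measurable]: "g i \<in> borel_measurable M" for i using g[of i] by auto
  have "(\<integral>\<^sup>+y. (\<Sum>i. ennreal \<bar>g i y\<bar>) \<partial>M) = (\<Sum>i. (\<integral>\<^sup>+y. ennreal \<bar>g i y\<bar> \<partial>M))"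
    by (intro nn_integral_suminf) auto
  also have "\<dots> = (\<Sum>i. ennreal (LINT y|M. \<bar>g i y\<bar>))"
    using g by (intro suminf_cong nn_integral_eq_integral) auto
  also have "\<dots> = ennreal (\<Sum>i. LINT y|M. \<bar>g i y\<bar>)"
    using s by (intro suminf_ennreal2) auto
  finally have "(\<integral>\<^sup>+y. (\<Sum>i. ennreal \<bar>g i y\<bar>) \<partial>M) \<noteq> \<infinity>" by simp
  then have "AE y in M. (\<Sum>i. ennreal \<bar>g i y\<bar>) \<noteq> \<infinity>"
    by (intro nn_integral_PInf_AE) auto
  then show 1: "AE y in M. summable (\<lambda>i. \<bar>g i y\<bar>)"
    by eventually_elim (auto intro!: summable_suminf_not_top)
  show "integrable M (\<lambda>y. \<Sum>i. g i y)"
    using g 1 s by (intro integrable_suminf) auto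
qed

lemma kernel_integral_abs_le:
  fixes x :: "'a::euclidean_space"
  assumes n: "2 \<le> n" and f: "integrable sphere_measure f" and x: "norm x = 1"
    and C: "\<And>t. \<bar>t\<bar> \<le> 1 \<Longrightarrow> \<bar>critical_kernel n N t\<bar> \<le> C"
  shows "(LINT y|sphere_measure. \<bar>critical_kernel n N (x \<bullet> y) * f y\<bar>) \<le> C * (LINT y|sphere_measure. \<bar>f y\<bar>)"
proof -
  have k: "continuous_on UNIV (critical_kernel n N)" using n by (intro continuous_on_cesaro_kernel) auto
  have "(LINT y|sphere_measure. \<bar>critical_kernel n N (x \<bullet> y) * f y\<bar>) \<le> (LINT y|sphere_measure. C * \<bar>f y\<bar>)"
  proof (rule integral_mono)
    fix y :: 'a assume "y \<in> space sphere_measure"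
    then have "\<bar>critical_kernel n N (x \<bullet> y)\<bar> \<le> C" using x by (intro C inner_sphere_bound) auto
    then show "\<bar>critical_kernel n N (x \<bullet> y) * f y\<bar> \<le> C * \<bar>f y\<bar>"
      unfolding abs_mult by (intro mult_right_mono) auto
  qed (use f integrable_kernel_mult[OF k f x] in auto)
  then show ?thesis by simp
qed

lemma critical_mean_series:
  fixes g :: "nat \<Rightarrow> 'a::euclidean_space \<Rightarrow> real"
  assumes n: "2 \<le> n" and g: "\<And>i. integrable sphere_measure (g i)"
    and s: "summable (\<lambda>i. LINT y|sphere_measure. \<bar>g i y\<bar>)" and x: "norm x = 1"
  shows "(\<lambda>i. critical_mean n N (g i) x) sums critical_mean n N (\<lambda>y. \<Sum>i. g i y) x"
proof -
  have k: "continuous_on UNIV (critical_kernel n N)" using n by (intro continuous_on_cesaro_kernel) auto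
  obtain C where C: "0 \<le> C" "\<And>t. \<bar>t\<bar> \<le> 1 \<Longrightarrow> \<bar>critical_kernel n N t\<bar> \<le> C"
    using bounded_on_unit_interval[OF k] by blast
  note ser = integrable_series[OF g s]
  have "(\<lambda>i. LINT y|sphere_measure. critical_kernel n N (x \<bullet> y) * g i y) sums
      (LINT y|sphere_measure. (\<Sum>i. critical_kernel n N (x \<bullet> y) * g i y))"
  proof (rule sums_integral)
    show "integrable sphere_measure (\<lambda>y. critical_kernel n N (x \<bullet> y) * g i y)" for i
      by (rule integrable_kernel_mult[OF k g x])
    show "AE y in sphere_measure. summable (\<lambda>i. norm (critical_kernel n N (x \<bullet> y) * g i y))"
      using ser(1) by eventually_elim (auto simp: abs_mult intro: summable_mult)
    show "summable (\<lambda>i. LINT y|sphere_measure. norm (critical_kernel n N (x \<bullet> y) * g i y))"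
    proof (rule summable_comparison_test'[OF summable_mult[OF s, of C], of 0])
      fix i
      show "norm (LINT y|sphere_measure. norm (critical_kernel n N (x \<bullet> y) * g i y)) \<le>
          C * (LINT y|sphere_measure. \<bar>g i y\<bar>)"
        using kernel_integral_abs_le[OF n g[of i] x C(2)] by simp
    qed
  qed
  moreover have "(LINT y|sphere_measure. (\<Sum>i. critical_kernel n N (x \<bullet> y) * g i y)) =
      (LINT y|sphere_measure. critical_kernel n N (x \<bullet> y) * (\<Sum>i. g i y))"
  proof (rule integral_cong_AE)
    have m: "(\<lambda>y. critical_kernel n N (x \<bullet> y)) \<in> borel_measurable sphere_measure"
      by (rule measurable_kernel_inner(1)[OF k])
    have gm: "g i \<in> borel_measurable sphere_measure" for i using g[of i] by auto
    show "(\<lambda>y. \<Sum>i. critical_kernel n N (x \<bullet> y) * g i y) \<in> borel_measurable sphere_measure"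
      using m gm by (intro borel_measurable_suminf borel_measurable_times)
    show "(\<lambda>y. critical_kernel n N (x \<bullet> y) * (\<Sum>i. g i y)) \<in> borel_measurable sphere_measure"
      using m gm by (intro borel_measurable_suminf borel_measurable_times)
    show "AE y in sphere_measure. (\<Sum>i. critical_kernel n N (x \<bullet> y) * g i y) =
        critical_kernel n N (x \<bullet> y) * (\<Sum>i. g i y)"
      using ser(1) by eventually_elim (auto intro!: suminf_mult summable_rabs_cancel)
  qed
  ultimately show ?thesis
    unfolding cesaro_mean_eq_kernel_integral[OF n g x] cesaro_mean_eq_kernel_integral[OF n ser(2) x] by simp
qed

lemma limsup_abs_eq_PInfty:
  fixes a :: "nat \<Rightarrow> real"
  assumes "\<And>r n. \<exists>N\<ge>n. r < \<bar>a N\<bar>"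
  shows "limsup (\<lambda>N. ereal \<bar>a N\<bar>) = \<infinity>"
proof (rule ccontr)
  assume "\<not> ?thesis"
  then obtain r :: nat where "limsup (\<lambda>N. ereal \<bar>a N\<bar>) < ereal (real r)"
    using less_PInf_Ex_of_nat[of "limsup (\<lambda>N. ereal \<bar>a N\<bar>)"] by auto
  then have "eventually (\<lambda>N. ereal \<bar>a N\<bar> < ereal (real r)) sequentially"
    by (rule Limsup_lessD)
  then obtain n where "\<And>N. N \<ge> n \<Longrightarrow> \<bar>a N\<bar> < real r"
    by (auto simp: eventually_sequentially)
  with assms[of n "real r"] show False by force
qed

text \<open>
  The perturbation added at stage \<open>k\<close> may be required to be small in terms of the indices \<open>\<nu> k\<close> that
  were used up to then, so that the later perturbations do not spoil the means that are already
  large.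
\<close>
lemma exists_gliding_hump:
  assumes dim: "DIM('a::euclidean_space) = n + 1" and n: "2 \<le> n"
    and \<eta>: "\<And>k N. 0 < (\<eta> k N :: real)"
  shows "\<exists>(g :: nat \<Rightarrow> 'a \<Rightarrow> real) \<nu> :: nat \<Rightarrow> nat.
     (\<forall>k. integrable sphere_measure (g k) \<and> (LINT y|sphere_measure. \<bar>g k y\<bar>) \<le> \<eta> k (\<nu> k)) \<and>
     strict_mono \<nu> \<and>
     (\<forall>k. 1 - (1 / 2) ^ k \<le> measure sphere_measure {x \<in> space sphere_measure.
        \<exists>N\<in>{\<nu> k..\<nu> (Suc k)}. real k < \<bar>critical_mean n N (\<lambda>y. \<Sum>i<Suc k. g i y) x\<bar>})"
proof -
  interpret S: prob_space "sphere_measure :: 'a measure" by (rule prob_space_sphere_measure)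
  \<comment> \<open>A state is the partial sum reached so far and the largest index used so far.\<close>
  define P where "P k s \<longleftrightarrow> integrable sphere_measure (fst s) \<and> (k = 0 \<longrightarrow> s = (\<lambda>_. 0, 0))"
    for k :: nat and s :: "('a \<Rightarrow> real) \<times> nat"
  define Q where "Q k s s' \<longleftrightarrow> (\<exists>g. integrable sphere_measure g \<and> (LINT y|sphere_measure. \<bar>g y\<bar>) \<le> \<eta> k (snd s) \<and>
      fst s' = (\<lambda>y. fst s y + g y) \<and> snd s < snd s' \<and>
      1 - (1 / 2) ^ k \<le> measure sphere_measure {x \<in> space sphere_measure.
        \<exists>N\<in>{snd s..snd s'}. real k < \<bar>critical_mean n N (fst s') x\<bar>})"
    for k :: nat and s s' :: "('a \<Rightarrow> real) \<times> nat"
  have "\<exists>s. \<forall>k. P k (s k) \<and> Q k (s k) (s (Suc k))"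
  proof (rule dependent_nat_choice)
    show "\<exists>s. P 0 s" by (auto simp: P_def)
    fix s k assume "P k s"
    then have h: "integrable sphere_measure (fst s)" by (simp add: P_def)
    obtain g N1 where g: "integrable sphere_measure g" "(LINT y|sphere_measure. \<bar>g y\<bar>) \<le> \<eta> k (snd s)"
      and m: "1 - (1 / 2) ^ k \<le> measure sphere_measure {x \<in> space sphere_measure.
          \<exists>N\<in>{snd s..N1}. real k < \<bar>critical_mean n N (\<lambda>y. fst s y + g y) x\<bar>}"
      using exists_perturbation[OF dim n h, of "(1 / 2) ^ k" "\<eta> k (snd s)" "real k" "snd s"] \<eta> by auto
    \<comment> \<open>The maximum makes \<open>\<nu>\<close> strictly increasing; enlarging the range of indices is harmless.\<close>
    define s' where "s' = (\<lambda>y. fst s y + g y, max N1 (Suc (snd s)))"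
    have int: "integrable sphere_measure (fst s')" using h g by (simp add: s'_def)
    have "{x \<in> space sphere_measure. \<exists>N\<in>{snd s..snd s'}. real k < \<bar>critical_mean n N (fst s') x\<bar>} =
       (\<Union>N\<in>{snd s..snd s'}. {x \<in> space sphere_measure. real k < \<bar>critical_mean n N (fst s') x\<bar>})" by auto
    also have "\<dots> \<in> sets sphere_measure"
      using measurable_critical_mean[of "fst s'" n] int by (intro sets.finite_UN borel_measurable_less) auto
    finally have "measure sphere_measure {x \<in> space sphere_measure.
          \<exists>N\<in>{snd s..N1}. real k < \<bar>critical_mean n N (\<lambda>y. fst s y + g y) x\<bar>} \<le>
        measure sphere_measure {x \<in> space sphere_measure.
          \<exists>N\<in>{snd s..snd s'}. real k < \<bar>critical_mean n N (fst s') x\<bar>}"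
      by (rule S.finite_measure_mono[rotated]) (force simp: s'_def)
    with m have "Q k s s'" unfolding Q_def using g
      by (intro exI[of _ g] conjI) (auto simp: s'_def)
    moreover have "P (Suc k) s'" using int by (simp add: P_def)
    ultimately show "\<exists>s'. P (Suc k) s' \<and> Q k s s'" by blast
  qed
  then obtain s where s: "\<And>k. P k (s k)" "\<And>k. Q k (s k) (s (Suc k))" by blast
  define \<nu> where "\<nu> k = snd (s k)" for k
  have "\<forall>k. \<exists>g. integrable sphere_measure g \<and> (LINT y|sphere_measure. \<bar>g y\<bar>) \<le> \<eta> k (\<nu> k) \<and>
      fst (s (Suc k)) = (\<lambda>y. fst (s k) y + g y) \<and> \<nu> k < \<nu> (Suc k) \<and>
      1 - (1 / 2) ^ k \<le> measure sphere_measure {x \<in> space sphere_measure.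
        \<exists>N\<in>{\<nu> k..\<nu> (Suc k)}. real k < \<bar>critical_mean n N (fst (s (Suc k))) x\<bar>}"
    using s(2) unfolding Q_def \<nu>_def by blast
  then obtain g where g: "\<And>k. integrable sphere_measure (g k)"
      "\<And>k. (LINT y|sphere_measure. \<bar>g k y\<bar>) \<le> \<eta> k (\<nu> k)"
    and step: "\<And>k. fst (s (Suc k)) = (\<lambda>y. fst (s k) y + g k y)" and \<nu>: "\<And>k. \<nu> k < \<nu> (Suc k)"
    and m: "\<And>k. 1 - (1 / 2) ^ k \<le> measure sphere_measure {x \<in> space sphere_measure.
        \<exists>N\<in>{\<nu> k..\<nu> (Suc k)}. real k < \<bar>critical_mean n N (fst (s (Suc k))) x\<bar>}"
    unfolding choice_iff by blast
  have "fst (s k) = (\<lambda>y. \<Sum>i<k. g i y)" for k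
  proof (induction k)
    case 0
    then show ?case using s(1)[of 0] by (simp add: P_def)
  next
    case (Suc k)
    then show ?case by (simp add: step)
  qed
  then show ?thesis
    using g m \<nu> by (intro exI[of _ g] exI[of _ \<nu>]) (simp add: strict_mono_Suc_iff)
qed

text \<open>
  The bounds \<open>\<eta>\<close> for the perturbations are chosen so that all terms after stage \<open>k\<close> together change the
  means with index at most \<open>\<nu> (k + 1)\<close> by at most \<open>2\<close>. By the Borel--Cantelli lemma, almost every \<open>x\<close>
  belongs to all but finitely many of the sets where stage \<open>k\<close> is successful.
\<close>
theorem exists_divergent_critical_means:
  assumes dim: "DIM('a::euclidean_space) = n + 1" and n: "2 \<le> n"
  shows "\<exists>f :: 'a \<Rightarrow> real. integrable sphere_measure f \<and>
     (AE x in sphere_measure. limsup (\<lambda>N. ereal \<bar>critical_mean n N f x\<bar>) = \<infinity>)"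
proof -
  interpret S: prob_space "sphere_measure :: 'a measure" by (rule prob_space_sphere_measure)
  have k: "continuous_on UNIV (critical_kernel n N)" for N
    using n by (intro continuous_on_cesaro_kernel) auto
  have "\<forall>N. \<exists>C\<ge>0. \<forall>t. \<bar>t\<bar> \<le> 1 \<longrightarrow> \<bar>critical_kernel n N t\<bar> \<le> C"
    using bounded_on_unit_interval[OF k] by blast
  then obtain C where C: "\<And>N. 0 \<le> C N" "\<And>N t. \<bar>t\<bar> \<le> 1 \<Longrightarrow> \<bar>critical_kernel n N t\<bar> \<le> C N"
    unfolding choice_iff by blast
  \<comment> \<open>A bound for all kernels of index at most \<open>N\<close>; the summand \<open>1\<close> makes it invertible.\<close>
  define D where "D N = 1 + (\<Sum>i\<le>N. C i)" for N
  have D0: "1 \<le> D N" for N using C(1) by (simp add: D_def sum_nonneg)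
  have CD: "C N \<le> D N'" if "N \<le> N'" for N N'
    using member_le_sum[of N "{..N'}" C] C(1) that by (auto simp: D_def)
  obtain g :: "nat \<Rightarrow> 'a \<Rightarrow> real" and \<nu> :: "nat \<Rightarrow> nat" where
      g: "\<And>i. integrable sphere_measure (g i)"
    and g1: "\<And>i. (LINT y|sphere_measure. \<bar>g i y\<bar>) \<le> (1 / 2) ^ i / D (\<nu> i)"
    and \<nu>: "strict_mono \<nu>"
    and large: "\<And>k. 1 - (1 / 2) ^ k \<le> measure sphere_measure {x \<in> space sphere_measure.
        \<exists>N\<in>{\<nu> k..\<nu> (Suc k)}. real k < \<bar>critical_mean n N (\<lambda>y. \<Sum>i<Suc k. g i y) x\<bar>}"
  proof -
    have "0 < (1 / 2) ^ k / D N" for k N using D0[of N] by (intro divide_pos_pos) auto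
    from exists_gliding_hump[where \<eta> = "\<lambda>k N. (1 / 2) ^ k / D N", OF dim n this]
    show ?thesis using that by blast
  qed
  have g2: "(LINT y|sphere_measure. \<bar>g i y\<bar>) \<le> (1 / 2) ^ i" for i
  proof -
    have "(1 / 2) ^ i / D (\<nu> i) \<le> (1 / 2) ^ i / 1" using D0[of "\<nu> i"] by (intro divide_left_mono) auto
    then show ?thesis using g1[of i] by simp
  qed
  have sum_g: "summable (\<lambda>i. LINT y|sphere_measure. \<bar>g i y\<bar>)"
    by (rule summable_comparison_test'[of "\<lambda>i. (1 / 2) ^ i" 0]) (use g2 in auto)
  define f where "f y = (\<Sum>i. g i y)" for y
  have f: "integrable sphere_measure f"
    unfolding f_def[abs_def] by (rule integrable_series(2)[OF g sum_g])
  define E where "E k = {x \<in> space sphere_measure.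
        \<exists>N\<in>{\<nu> k..\<nu> (Suc k)}. real k < \<bar>critical_mean n N (\<lambda>y. \<Sum>i<Suc k. g i y) x\<bar>}" for k
  have E: "E k \<in> sets sphere_measure" for k
  proof -
    have "(\<lambda>y. \<Sum>i<Suc k. g i y) \<in> borel_measurable sphere_measure"
      using g by (intro borel_measurable_sum) auto
    note meas = measurable_critical_mean[OF this]
    have "E k = (\<Union>N\<in>{\<nu> k..\<nu> (Suc k)}. {x \<in> space sphere_measure.
        real k < \<bar>critical_mean n N (\<lambda>y. \<Sum>i<Suc k. g i y) x\<bar>})" by (auto simp: E_def)
    also have "\<dots> \<in> sets sphere_measure"
      using meas by (intro sets.finite_UN borel_measurable_less borel_measurable_abs) auto
    finally show ?thesis .
  qed
  have "AE x in sphere_measure. eventually (\<lambda>k. x \<in> space sphere_measure - (space sphere_measure - E k)) sequentially"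
  proof (rule borel_cantelli_AE1)
    show "summable (\<lambda>k. measure sphere_measure (space sphere_measure - E k))"
    proof (rule summable_comparison_test'[of "\<lambda>k. (1 / 2) ^ k" 0])
      fix k
      show "norm (measure sphere_measure (space sphere_measure - E k)) \<le> (1 / 2) ^ k"
        using large[of k] S.prob_compl[OF E[of k]] unfolding E_def[symmetric] by simp
    qed auto
    show "space sphere_measure - E k \<in> sets sphere_measure" for k
      by (rule sets.compl_sets[OF E])
  qed (auto simp: S.emeasure_finite less_top[symmetric])
  then have "AE x in sphere_measure. limsup (\<lambda>N. ereal \<bar>critical_mean n N f x\<bar>) = \<infinity>"
    using AE_space
  proof eventually_elim
    case (elim x)
    then have x: "norm x = 1" by simp
    obtain k0 where k0: "\<And>k. k \<ge> k0 \<Longrightarrow> x \<in> E k"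
      using elim(1) by (auto simp: eventually_sequentially)
    show ?case
    proof (rule limsup_abs_eq_PInfty)
      fix r :: real and m :: nat
      obtain r' :: nat where r': "r + 2 < real r'" using reals_Archimedean2 by blast
      define k where "k = max k0 (max m r')"
      have "x \<in> E k" by (rule k0) (simp add: k_def)
      then obtain N where N: "N \<in> {\<nu> k..\<nu> (Suc k)}"
        and big: "real k < \<bar>critical_mean n N (\<lambda>y. \<Sum>i<Suc k. g i y) x\<bar>" by (auto simp: E_def)
      let ?a = "\<lambda>i. critical_mean n N (g i) x"
      have partial: "critical_mean n N (\<lambda>y. \<Sum>i<j. g i y) x = (\<Sum>i<j. ?a i)" for j
      proof -
        have int: "integrable sphere_measure (\<lambda>y. \<Sum>i<j. g i y)" using g by simp
        show ?thesis
          unfolding cesaro_mean_eq_kernel_integral[OF n int x] cesaro_mean_eq_kernel_integral[OF n g x] sum_distrib_left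
          using integrable_kernel_mult[OF k g x] by (intro Bochner_Integration.integral_sum) auto
      qed
      have sums: "?a sums critical_mean n N f x"
        unfolding f_def[abs_def] by (rule critical_mean_series[OF n g sum_g x])
      have tail: "norm (?a (i + Suc k)) \<le> (1 / 2) ^ i" for i
      proof -
        let ?i = "i + Suc k"
        have "N \<le> \<nu> ?i" using N strict_mono_leD[OF \<nu>, of "Suc k" ?i] by simp
        note CD = CD[OF this]
        have "norm (?a ?i) \<le> (LINT y|sphere_measure. \<bar>critical_kernel n N (x \<bullet> y) * g ?i y\<bar>)"
          unfolding cesaro_mean_eq_kernel_integral[OF n g x] real_norm_def by (rule integral_abs_bound)
        also have "\<dots> \<le> C N * (LINT y|sphere_measure. \<bar>g ?i y\<bar>)"
          by (rule kernel_integral_abs_le[OF n g x C(2)])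
        also have "\<dots> \<le> D (\<nu> ?i) * ((1 / 2) ^ ?i / D (\<nu> ?i))"
          using CD g1[of ?i] C(1)[of N] D0[of "\<nu> ?i"] by (intro mult_mono) auto
        also have "\<dots> = (1 / 2) ^ ?i" using D0[of "\<nu> ?i"] by simp
        also have "\<dots> \<le> (1 / 2) ^ i" by (intro power_decreasing) auto
        finally show ?thesis .
      qed
      have "critical_mean n N f x = (\<Sum>i. ?a (i + Suc k)) + (\<Sum>i<Suc k. ?a i)"
        using sums suminf_split_initial_segment[OF sums_summable[OF sums], of "Suc k"] by (simp add: sums_iff)
      moreover have "norm (\<Sum>i. ?a (i + Suc k)) \<le> (\<Sum>i. (1 / 2) ^ i)"
        by (rule norm_suminf_le[OF tail]) simp
      moreover have "(\<Sum>i. (1 / 2) ^ i) = (2 :: real)" using suminf_geometric[of "1 / 2 :: real"] by simp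
      ultimately have "r < \<bar>critical_mean n N f x\<bar>"
        using big r' unfolding partial k_def real_norm_def by linarith
      moreover have "m \<le> N"
        using N strict_mono_imp_increasing[OF \<nu>, of k] by (simp add: k_def)
      ultimately show "\<exists>N\<ge>m. r < \<bar>critical_mean n N f x\<bar>" by blast
    qed
  qed
  with f show ?thesis by blast
qed

theorem theorem1:
  fixes n :: nat
  assumes "n \<ge> 2" and "CARD('d::finite) = n + 1"
  shows "\<exists>f :: real ^ 'd \<Rightarrow> real.
           integrable sphere_measure f \<and>
           (AE x in sphere_measure.
              limsup (\<lambda>N. ereal \<bar>cesaro_mean n ((real n - 1) / 2) N f x\<bar>) = \<infinity>)"
  using assms by (intro exists_divergent_critical_means) simp_all

end
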